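(* Let $(m_n)_{n\ge 1}$ be a sequence of positive integers with $m_n\to\infty$ as $n\to\infty$. For each $n\ge 1$ let $X_n$ be a random variable with values in $\{1,\ldots,m_n\}$ and $\mathbb{P}(X_n=i)=p_n(i)>0$ for $i=1,\ldots,m_n$, let $X_{n,1},\ldots,X_{n,n}$ be iid random variables with the same distribution as $X_n$, and let $\chi_n^2$ be the associated Pearson chi-square statistic. Assume that $$\frac{1}{m_n n}\,\mathrm{Var}\!\left(\frac{1}{p_n(X_n)}\right)\to 0\quad\text{as } n\to\infty,$$ that there exists $\delta>0$ such that $$\sup_{n}\ m_n^{-(1+\delta)}\,\mathbb{E}\!\left[p_n(X_n)^{-(1+\delta)}\right]<\infty,$$ and that $$\frac{n}{\sqrt{m_n}}\to\infty\quad\text{as } n\to\infty.$$ Then, as $n\to\infty$, $$\frac{\chi_n^2-m_n}{\sqrt{2m_n}}\ \stackrel{d}{\to}\ N,$$ where $N$ is a standard normal random variable (mean $0$, variance $1$).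
   Context: The Pearson chi-square statistic is $$\chi_n^2=n\sum_{i=1}^{m_n}\frac{(\hat p_n(i)-p_n(i))^2}{p_n(i)},\qquad \hat p_n(i)=\frac1n\sum_{k=1}^n I(X_{n,k}=i),\quad i=1,\ldots,m_n,$$ where $I(\cdot)$ denotes the indicator of an event. The random variable $p_n(X_n)$ is the function $i\mapsto p_n(i)$ evaluated at $X_n$. The symbol $\stackrel{d}{\to}$ denotes convergence in distribution. *)

theory Defs
  imports "HOL-Probability.Probability"
begin

definition emp_freq :: "nat \<Rightarrow> (nat \<Rightarrow> 'a \<Rightarrow> nat) \<Rightarrow> nat \<Rightarrow> 'a \<Rightarrow> real" where
  "emp_freq n Y i \<omega> = 1 / real n * (\<Sum>k=1..n. of_bool (Y k \<omega> = i))"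

definition pearson_chi2 ::
    "nat \<Rightarrow> nat \<Rightarrow> (nat \<Rightarrow> real) \<Rightarrow> (nat \<Rightarrow> 'a \<Rightarrow> nat) \<Rightarrow> 'a \<Rightarrow> real" where
  "pearson_chi2 n m p Y \<omega> = real n * (\<Sum>i=1..m. (emp_freq n Y i \<omega> - p i)\<^sup>2 / p i)"

end

theory Submission
  imports Defs
begin

text \<open>
  Put $h(x,y) = 1\{x=y\}/p(x) - 1$. Then $n\chi^2_n = \sum_{k,l\le n} h(X_k,X_l)$; after centring, the
  diagonal terms are negligible by the variance condition, and the sums over $k<l$ form a martingale $U_l$ because $h$ is degenerate.
  As $h$ is the kernel of a projection in $L^2(p)$, the conditional variance of the increment at time
  $l+1$ is exactly $2U_l$ plus the diagonal terms, so the normalised quadratic variation tends to $1$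
  in $L^1$. For the Lyapunov sum, the conditional second and fourth moments of the increment given
  its last observation $x$ reduce everything to $E[y\min(1,\kappa y^2)]$ with
  $y = 1/(m\,p(X))$ and $\kappa$ of order $m/n^2$, up to lower order; this vanishes since $y$ is
  uniformly integrable. The central limit theorem itself comes from telescoping
  $\exp(itS + t^2V/2)$, with $V$ the quadratic variation, stopped before $V$ exceeds $2$.
\<close>

section \<open>Expectations over finite samples\<close>

text \<open>All estimates before the limit are inequalities for a fixed n, in terms of n, the number
  m of categories, the variance of 1/p(X), the (1 + \<delta>)-moment of y = 1/(m p(X)) and one free
  level L. Samples of length n form a finite set, so conditioning on the past is a finite sum over
  the next observation. The limit is taken once, at the end. The factor exp(t^2 V/2) cancels the
  conditional characteristic functions, but it is unbounded, which is why the process is stopped.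
  Since V is determined by the past, the stop can come before the level is passed, and the modulus
  stays below exp(t^2). The obstacle in the Lyapunov sum is that only moments of 1/p(X) of order 1 +
  \<delta> are controlled, while the fourth moment of an increment involves the third power of
  1/p(X). Fourth moments are therefore used only for y \<le> L; for larger y the second moment is
  used, at a cost of order L^(-\<delta>). L has to grow because of this tail, and slowly because of
  the rest. With L^5 = n / sqrt m both hold, and here the growth of n / sqrt m enters.\<close>

locale finite_law =
  fixes A :: "'a set" and p :: "'a \<Rightarrow> real"
  assumes finite_A: "finite A"
    and p_pos: "\<And>x. x \<in> A \<Longrightarrow> p x > 0"
    and sum_p: "sum p A = 1"
begin

definition samples :: "nat \<Rightarrow> 'a list set" where
  "samples n = {xs. set xs \<subseteq> A \<and> length xs = n}"

text \<open>The weight is the product law of n independent draws. Values lie in a real vector space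
  so that one operator averages both real moments and complex exponentials.\<close>

definition expect :: "nat \<Rightarrow> ('a list \<Rightarrow> 'b::real_vector) \<Rightarrow> 'b" where
  "expect n f = (\<Sum>xs\<in>samples n. prod_list (map p xs) *\<^sub>R f xs)"

lemma finite_samples [simp]: "finite (samples n)"
  unfolding samples_def by (rule finite_lists_length_eq[OF finite_A])

lemma samplesD: "xs \<in> samples n \<Longrightarrow> set xs \<subseteq> A"
  by (simp add: samples_def)

lemma weight_nonneg: "set xs \<subseteq> A \<Longrightarrow> prod_list (map p xs) \<ge> 0"
  by (induction xs) (auto intro!: mult_nonneg_nonneg dest: p_pos less_imp_le)

lemma expect_0 [simp]: "expect 0 f = f []"
  by (simp add: expect_def samples_def conj_commute cong: conj_cong)

text \<open>Tower property: the inner sum is the conditional expectation over the newest observation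
  given the past \<open>xs\<close>. The inductions on the sample size rest on it.\<close>

lemma expect_Suc: "expect (Suc n) f = expect n (\<lambda>xs. \<Sum>x\<in>A. p x *\<^sub>R f (x # xs))"
proof -
  have "expect (Suc n) f = (\<Sum>(x, xs)\<in>A \<times> samples n. prod_list (map p (x # xs)) *\<^sub>R f (x # xs))"
    unfolding expect_def
    by (rule sum.reindex_bij_witness[where i = "\<lambda>(x, xs). x # xs" and j = "\<lambda>xs. (hd xs, tl xs)"])
      (auto simp: samples_def length_Suc_conv)
  also have "\<dots> = (\<Sum>xs\<in>samples n. \<Sum>x\<in>A. prod_list (map p (x # xs)) *\<^sub>R f (x # xs))"
    unfolding sum.cartesian_product[symmetric] by (rule sum.swap)
  finally show ?thesis
    by (simp add: expect_def scaleR_sum_right mult.commute)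
qed

lemma expect_cong: "(\<And>xs. xs \<in> samples n \<Longrightarrow> f xs = g xs) \<Longrightarrow> expect n f = expect n g"
  by (simp add: expect_def)

lemma expect_add: "expect n (\<lambda>xs. f xs + g xs) = expect n f + expect n g"
  by (simp add: expect_def scaleR_right_distrib sum.distrib)

lemma expect_diff: "expect n (\<lambda>xs. f xs - g xs) = expect n f - expect n g"
  by (simp add: expect_def scaleR_right_diff_distrib sum_subtractf)

lemma expect_const: "expect n (\<lambda>_. c) = c"
proof (induction n)
  case (Suc n)
  have "expect (Suc n) (\<lambda>_. c) = expect n (\<lambda>_. (\<Sum>x\<in>A. p x) *\<^sub>R c)"
    by (simp add: expect_Suc scaleR_sum_left)
  then show ?case by (simp add: sum_p Suc.IH)
qed simp

lemma expect_mult_left: "expect n (\<lambda>xs. c * f xs) = c * expect n f" for c :: real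
  by (simp add: expect_def sum_distrib_left algebra_simps)

lemma expect_mult_right: "expect n (\<lambda>xs. f xs * c) = expect n f * c"
  for c :: "'c::real_algebra"
  by (simp add: expect_def sum_distrib_right)

lemma expect_sum: "expect n (\<lambda>xs. \<Sum>x\<in>B. f x xs) = (\<Sum>x\<in>B. expect n (f x))"
  unfolding expect_def scaleR_sum_right by (rule sum.swap)

lemma expect_mono:
  "(\<And>xs. xs \<in> samples n \<Longrightarrow> f xs \<le> g xs) \<Longrightarrow> expect n f \<le> expect n g" for f g :: "_ \<Rightarrow> real"
  by (auto simp: expect_def samples_def intro!: sum_mono mult_left_mono weight_nonneg)

lemma expect_nonneg:
  "(\<And>xs. xs \<in> samples n \<Longrightarrow> 0 \<le> f xs) \<Longrightarrow> 0 \<le> expect n f" for f :: "_ \<Rightarrow> real"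
  using expect_mono[of n "\<lambda>_. 0" f] by (simp add: expect_const)

lemma norm_expect_le: "norm (expect n f) \<le> expect n (\<lambda>xs. norm (f xs))"
  for f :: "_ \<Rightarrow> 'c::real_normed_vector"
  unfolding expect_def
  by (rule order_trans[OF norm_sum]) (auto intro!: sum_mono simp: weight_nonneg samplesD)

text \<open>The variance of \<open>\<bar>f xs\<bar>\<close> is nonnegative.\<close>

lemma expect_abs_le_sqrt: "expect n (\<lambda>xs. \<bar>f xs\<bar>) \<le> sqrt (expect n (\<lambda>xs. (f xs)\<^sup>2))"
proof -
  let ?a = "expect n (\<lambda>xs. \<bar>f xs\<bar>)"
  have "0 \<le> expect n (\<lambda>xs. (\<bar>f xs\<bar> - ?a)\<^sup>2)"
    by (rule expect_nonneg) simp
  also have "\<dots> = expect n (\<lambda>xs. ((f xs)\<^sup>2 + ?a\<^sup>2) - (2 * ?a) * \<bar>f xs\<bar>)"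
    by (simp add: power2_diff algebra_simps)
  also have "\<dots> = expect n (\<lambda>xs. (f xs)\<^sup>2) - ?a\<^sup>2"
    unfolding expect_diff expect_add expect_const expect_mult_left
    by (simp add: power2_eq_square)
  finally show ?thesis by (intro real_le_rsqrt) simp
qed

text \<open>Samples grow at the head: in \<open>x # xs\<close> the latest observation is \<open>x\<close> and its past is \<open>xs\<close>.\<close>

primrec partial_sum :: "('a \<Rightarrow> 'a list \<Rightarrow> real) \<Rightarrow> 'a list \<Rightarrow> real" where
  "partial_sum d [] = 0"
| "partial_sum d (x # xs) = partial_sum d xs + d x xs"

definition cond_var :: "('a \<Rightarrow> 'a list \<Rightarrow> real) \<Rightarrow> 'a list \<Rightarrow> real" where
  "cond_var d xs = (\<Sum>x\<in>A. p x * (d x xs)\<^sup>2)"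

definition martingale_diff :: "('a \<Rightarrow> 'a list \<Rightarrow> real) \<Rightarrow> bool" where
  "martingale_diff d \<longleftrightarrow> (\<forall>xs. set xs \<subseteq> A \<longrightarrow> (\<Sum>x\<in>A. p x * d x xs) = 0)"

lemma martingale_diffD: "martingale_diff d \<Longrightarrow> set xs \<subseteq> A \<Longrightarrow> (\<Sum>x\<in>A. p x * d x xs) = 0"
  by (simp add: martingale_diff_def)

lemma cond_var_nonneg: "cond_var d xs \<ge> 0"
  unfolding cond_var_def by (intro sum_nonneg mult_nonneg_nonneg) (auto dest: p_pos less_imp_le)

lemma expect_partial_sum:
  "expect n (partial_sum d) = (\<Sum>l<n. expect l (\<lambda>xs. \<Sum>x\<in>A. p x * d x xs))"
proof (induction n)
  case (Suc n)
  have "expect (Suc n) (partial_sum d) =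
      expect n (\<lambda>xs. (\<Sum>x\<in>A. p x) * partial_sum d xs + (\<Sum>x\<in>A. p x * d x xs))"
    unfolding expect_Suc
    by (simp add: ring_distribs sum.distrib sum_distrib_right)
  then show ?case using Suc.IH by (simp add: sum_p expect_add)
qed simp

text \<open>Orthogonality of increments: given the past, the cross term is a fixed factor times an
  increment of mean zero.\<close>

lemma expect_partial_sum_sq:
  assumes "martingale_diff d"
  shows "expect n (\<lambda>xs. (partial_sum d xs)\<^sup>2) = (\<Sum>l<n. expect l (cond_var d))"
proof (induction n)
  case (Suc n)
  have "expect (Suc n) (\<lambda>xs. (partial_sum d xs)\<^sup>2) =
      expect n (\<lambda>xs. (partial_sum d xs)\<^sup>2 * (\<Sum>x\<in>A. p x)
        + 2 * partial_sum d xs * (\<Sum>x\<in>A. p x * d x xs) + cond_var d xs)"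
    unfolding expect_Suc cond_var_def sum_distrib_left
    by (simp add: power2_sum ring_distribs sum.distrib sum_distrib_left
        mult.assoc mult.left_commute mult.commute add.assoc add.left_commute add.commute)
  also have "\<dots> = expect n (\<lambda>xs. (partial_sum d xs)\<^sup>2 + cond_var d xs)"
    by (rule expect_cong) (simp add: sum_p martingale_diffD[OF assms] samplesD)
  finally show ?case using Suc.IH by (simp add: expect_add)
qed simp

end

section \<open>A martingale bound for characteristic functions\<close>

text \<open>Both bounds are kept: the cubic one is sharp for small increments, the quadratic one
  still works where no third moment is under control.\<close>

lemma iexp_quadratic_remainder:
  "cmod (iexp u - (1 + \<i> * u - of_real (u\<^sup>2 / 2))) \<le> min (u\<^sup>2) (\<bar>u\<bar> ^ 3 / 6)" for u :: real
proof -
  have *: "(\<Sum>k\<le>2. (\<i> * complex_of_real u) ^ k / fact k) = 1 + \<i> * u - of_real (u\<^sup>2 / 2)"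
    by (simp add: numeral_2_eq_2 fact_numeral power_mult_distrib)
  show ?thesis
    using iexp_approx1[of u 2] iexp_approx2[of u 2] unfolding *
    by (simp add: fact_numeral eval_nat_numeral)
qed

text \<open>The upper half comes from the quadratic lower bound for \<open>exp z\<close>: the
  product of 1 - z + z^2/2 and 1 + z + z^2/2 is 1 + z^4/4, so the first factor is at least the
  reciprocal of the second.\<close>

lemma exp_neg_remainder: "\<bar>exp (- z) - (1 - z)\<bar> \<le> z\<^sup>2 / 2" if "z \<ge> 0" for z :: real
proof -
  have 1: "1 - z \<le> exp (- z)" using exp_ge_add_one_self[of "- z"] by simp
  have "1 + z + z\<^sup>2 / 2 \<le> exp z" using that by (rule exp_lower_Taylor_quadratic)
  then have "exp (- z) * (1 + z + z\<^sup>2 / 2) \<le> 1"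
    by (simp add: exp_minus divide_simps)
  moreover have "(1 - z + z\<^sup>2 / 2) * (1 + z + z\<^sup>2 / 2) = 1 + (z\<^sup>2 / 2)\<^sup>2"
    by (simp add: algebra_simps power2_eq_square)
  ultimately have "exp (- z) * (1 + z + z\<^sup>2 / 2) \<le> (1 - z + z\<^sup>2 / 2) * (1 + z + z\<^sup>2 / 2)"
    using zero_le_power2[of "z\<^sup>2 / 2"] by linarith
  then have "exp (- z) \<le> 1 - z + z\<^sup>2 / 2"
    using that by (subst (asm) mult_le_cancel_right_pos) (auto intro!: add_pos_nonneg)
  then show ?thesis using 1 by (simp add: abs_le_iff)
qed

lemma abs_exp_diff_le: "\<bar>exp a - exp b\<bar> \<le> exp c * \<bar>a - b\<bar>" if "a \<le> c" "b \<le> c" for a b c :: real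
proof -
  have *: "exp y - exp x \<le> exp c * (y - x)" if "x \<le> y" "y \<le> c" for x y :: real
  proof -
    have "exp y - exp x = exp y * (1 - exp (x - y))"
      by (simp add: right_diff_distrib flip: exp_add)
    also have "1 - exp (x - y) \<le> y - x"
      using exp_ge_add_one_self[of "x - y"] by linarith
    then have "exp y * (1 - exp (x - y)) \<le> exp y * (y - x)" by simp
    also have "\<dots> \<le> exp c * (y - x)"
      using that by (intro mult_right_mono) auto
    finally show ?thesis .
  qed
  show ?thesis
  proof (cases "a \<le> b")
    case True
    then show ?thesis using *[of a b] that by simp
  next
    case False
    then show ?thesis using *[of b a] that by simp
  qed
qed

context finite_law
begin

definition lyapunov :: "real \<Rightarrow> ('a \<Rightarrow> 'a list \<Rightarrow> real) \<Rightarrow> 'a list \<Rightarrow> real" where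
  "lyapunov t d xs = (\<Sum>x\<in>A. p x * min ((t * d x xs)\<^sup>2) (\<bar>t * d x xs\<bar> ^ 3 / 6))"

text \<open>In the Taylor expansion the linear term vanishes by the martingale property and the
  quadratic one leaves 1 - z, where z is t^2/2 times the conditional variance. Passing from 1 - z to
  exp(-z) costs z^2/2.\<close>

lemma cond_char_bound:
  assumes d: "martingale_diff d" and xs: "set xs \<subseteq> A"
  shows "cmod ((\<Sum>x\<in>A. p x *\<^sub>R iexp (t * d x xs)) - of_real (exp (- (t\<^sup>2 / 2 * cond_var d xs))))
    \<le> lyapunov t d xs + (t\<^sup>2 / 2 * cond_var d xs)\<^sup>2 / 2"
proof -
  let ?z = "t\<^sup>2 / 2 * cond_var d xs"
  let ?q = "\<lambda>u::real. 1 + \<i> * u - of_real (u\<^sup>2 / 2) :: complex"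
  have "(\<Sum>x\<in>A. p x *\<^sub>R ?q (t * d x xs)) =
      of_real (\<Sum>x\<in>A. p x) + \<i> * of_real (t * (\<Sum>x\<in>A. p x * d x xs)) - of_real ?z"
    unfolding cond_var_def sum_distrib_left of_real_sum
    by (simp add: scaleR_conv_of_real algebra_simps sum.distrib sum_subtractf sum_distrib_left power_mult_distrib)
  then have q: "(\<Sum>x\<in>A. p x *\<^sub>R ?q (t * d x xs)) = of_real (1 - ?z)"
    by (simp add: sum_p martingale_diffD[OF d xs])
  have "cmod ((\<Sum>x\<in>A. p x *\<^sub>R iexp (t * d x xs)) - of_real (1 - ?z)) =
      cmod (\<Sum>x\<in>A. p x *\<^sub>R (iexp (t * d x xs) - ?q (t * d x xs)))"
    unfolding q[symmetric] by (simp only: sum_subtractf scaleR_right_diff_distrib)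
  also have "\<dots> \<le> lyapunov t d xs"
    unfolding lyapunov_def
  proof (rule sum_norm_le)
    fix x assume "x \<in> A"
    then have "norm (p x *\<^sub>R (iexp (t * d x xs) - ?q (t * d x xs))) = p x * cmod (iexp (t * d x xs) - ?q (t * d x xs))"
      using p_pos[of x] by (simp only: norm_scaleR) simp
    also have "\<dots> \<le> p x * min ((t * d x xs)\<^sup>2) (\<bar>t * d x xs\<bar> ^ 3 / 6)"
      using p_pos[OF \<open>x \<in> A\<close>] by (intro mult_left_mono iexp_quadratic_remainder) simp
    finally show "norm (p x *\<^sub>R (iexp (t * d x xs) - ?q (t * d x xs))) \<le> \<dots>" .
  qed
  finally have 1: "cmod ((\<Sum>x\<in>A. p x *\<^sub>R iexp (t * d x xs)) - of_real (1 - ?z)) \<le> lyapunov t d xs" .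
  have "cmod (of_real (1 - ?z) - of_real (exp (- ?z))) = \<bar>exp (- ?z) - (1 - ?z)\<bar>"
    unfolding of_real_diff[symmetric] norm_of_real by (rule abs_minus_commute)
  also have "\<dots> \<le> ?z\<^sup>2 / 2"
    by (rule exp_neg_remainder) (simp add: cond_var_nonneg)
  finally show ?thesis
    using 1 norm_triangle_ineq[of "(\<Sum>x\<in>A. p x *\<^sub>R iexp (t * d x xs)) - of_real (1 - ?z)"
      "of_real (1 - ?z) - of_real (exp (- ?z))"] by simp
qed

section \<open>Telescoping the stopped exponential process\<close>

text \<open>The summand ignores the newest observation, so the value at \<open>x # xs\<close> is
  already fixed by \<open>xs\<close>: the process is predictable.\<close>

abbreviation quad_var :: "('a \<Rightarrow> 'a list \<Rightarrow> real) \<Rightarrow> 'a list \<Rightarrow> real" where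
  "quad_var d \<equiv> partial_sum (\<lambda>_. cond_var d)"

definition exp_process :: "real \<Rightarrow> ('a \<Rightarrow> 'a list \<Rightarrow> real) \<Rightarrow> 'a list \<Rightarrow> complex" where
  "exp_process t d xs = iexp (t * partial_sum d xs) * of_real (exp (t\<^sup>2 / 2 * quad_var d xs))"

text \<open>Because \<open>quad_var\<close> never decreases as the sample grows, the value is frozen
  for good once the level 2 is passed. Any level above the limiting value 1 would serve; 2 turns the
  modulus bound into exp(t^2).\<close>

primrec stopped_process :: "real \<Rightarrow> ('a \<Rightarrow> 'a list \<Rightarrow> real) \<Rightarrow> 'a list \<Rightarrow> complex" where
  "stopped_process t d [] = 1"
| "stopped_process t d (x # xs) =
    (if quad_var d (x # xs) \<le> 2 then exp_process t d (x # xs) else stopped_process t d xs)"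

lemma stopped_process_eq: "quad_var d xs \<le> 2 \<Longrightarrow> stopped_process t d xs = exp_process t d xs"
  by (cases xs) (auto simp: exp_process_def)

lemma norm_exp_process: "cmod (exp_process t d xs) = exp (t\<^sup>2 / 2 * quad_var d xs)"
  by (simp add: exp_process_def norm_mult)

lemma norm_stopped_process: "cmod (stopped_process t d xs) \<le> exp (t\<^sup>2)"
proof (induction xs)
  case (Cons x xs)
  have "t\<^sup>2 / 2 * quad_var d (x # xs) \<le> t\<^sup>2 / 2 * 2" if "quad_var d (x # xs) \<le> 2"
    using that by (intro mult_left_mono) auto
  then show ?case using Cons by (auto simp: norm_exp_process simp del: partial_sum.simps)
qed simp

text \<open>Whether the level is passed does not depend on \<open>x\<close>. If it is not, the mean
  step is the old value times exp(v) times the error in \<open>cond_char_bound\<close>, where v is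
  t^2/2 times the conditional variance; if it is, the process is frozen and the step
  vanishes.\<close>

lemma stopped_process_step:
  assumes d: "martingale_diff d" and xs: "set xs \<subseteq> A"
  shows "cmod ((\<Sum>x\<in>A. p x *\<^sub>R stopped_process t d (x # xs)) - stopped_process t d xs)
    \<le> exp (t\<^sup>2) * (lyapunov t d xs + (t\<^sup>2 / 2 * cond_var d xs)\<^sup>2 / 2)"
proof (cases "quad_var d xs + cond_var d xs \<le> 2")
  case True
  let ?v = "t\<^sup>2 / 2 * cond_var d xs"
  have "quad_var d xs \<le> 2" using True cond_var_nonneg[of d xs] by linarith
  then have "stopped_process t d xs = exp_process t d xs" by (rule stopped_process_eq)
  moreover have "exp_process t d (x # xs) = (exp_process t d xs * of_real (exp ?v)) * iexp (t * d x xs)" for x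
    by (simp add: exp_process_def ring_distribs exp_add)
  moreover have "exp_process t d xs = (exp_process t d xs * of_real (exp ?v)) * of_real (exp (- ?v))"
    by (simp add: exp_minus)
  ultimately have "(\<Sum>x\<in>A. p x *\<^sub>R stopped_process t d (x # xs)) - stopped_process t d xs =
    (exp_process t d xs * of_real (exp ?v)) *
      ((\<Sum>x\<in>A. p x *\<^sub>R iexp (t * d x xs)) - of_real (exp (- ?v)))"
    using True by (simp add: sum_distrib_left right_diff_distrib)
  moreover have "cmod (exp_process t d xs * of_real (exp ?v)) \<le> exp (t\<^sup>2)"
  proof -
    have "t\<^sup>2 / 2 * (quad_var d xs + cond_var d xs) \<le> t\<^sup>2 / 2 * 2"
      using True by (intro mult_left_mono) auto
    then show ?thesis by (simp add: norm_mult norm_exp_process algebra_simps flip: exp_add)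
  qed
  ultimately show ?thesis
    using cond_char_bound[OF d xs, of t] by (simp only: norm_mult) (intro mult_mono, auto)
next
  case False
  have "(\<Sum>x\<in>A. p x *\<^sub>R stopped_process t d (x # xs)) - stopped_process t d xs = 0"
    using False by (simp add: sum_p flip: scaleR_sum_left)
  moreover have "lyapunov t d xs \<ge> 0"
    unfolding lyapunov_def using p_pos by (intro sum_nonneg mult_nonneg_nonneg) (auto intro: less_imp_le)
  ultimately show ?thesis by simp
qed

lemma expect_stopped_process:
  assumes d: "martingale_diff d"
  shows "cmod (expect n (stopped_process t d) - 1) \<le>
    exp (t\<^sup>2) * (\<Sum>l<n. expect l (\<lambda>xs. lyapunov t d xs + (t\<^sup>2 / 2 * cond_var d xs)\<^sup>2 / 2))"
proof (induction n)
  case (Suc n)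
  have "cmod (expect (Suc n) (stopped_process t d) - expect n (stopped_process t d)) \<le>
      expect n (\<lambda>xs. cmod ((\<Sum>x\<in>A. p x *\<^sub>R stopped_process t d (x # xs)) - stopped_process t d xs))"
    unfolding expect_Suc expect_diff[symmetric] by (rule norm_expect_le)
  also have "\<dots> \<le> expect n (\<lambda>xs. exp (t\<^sup>2) * (lyapunov t d xs + (t\<^sup>2 / 2 * cond_var d xs)\<^sup>2 / 2))"
    by (intro expect_mono stopped_process_step[OF d] samplesD)
  finally show ?case
    using Suc norm_triangle_ineq[of "expect (Suc n) (stopped_process t d) - expect n (stopped_process t d)"
      "expect n (stopped_process t d) - 1"]
    unfolding expect_mult_left sum.lessThan_Suc 
    unfolding distrib_left add_diff_eq diff_add_cancel by linarith
qed simp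

text \<open>After multiplication by exp(t^2/2) the exponential is compared with the stopped process.
  Where V \<le> 2, two real exponentials differ by at most exp(t^2) t^2/2 |V - 1|; where V > 2, the
  crude bound 2 exp(t^2) suffices since |V - 1| > 1. This is the origin of 2 + t^2/2.\<close>

lemma martingale_char_bound:
  assumes d: "martingale_diff d"
  shows "cmod (expect n (\<lambda>xs. iexp (t * partial_sum d xs)) - of_real (exp (- (t\<^sup>2) / 2))) \<le>
    exp (t\<^sup>2) * ((\<Sum>l<n. expect l (lyapunov t d)) + t ^ 4 / 8 * (\<Sum>l<n. expect l (\<lambda>xs. (cond_var d xs)\<^sup>2))
      + (2 + t\<^sup>2 / 2) * expect n (\<lambda>xs. \<bar>quad_var d xs - 1\<bar>))"
proof -
  let ?e = "complex_of_real (exp (t\<^sup>2 / 2))"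
  have pw: "cmod (iexp (t * partial_sum d xs) * ?e - stopped_process t d xs)
      \<le> (exp (t\<^sup>2) * (2 + t\<^sup>2 / 2)) * \<bar>quad_var d xs - 1\<bar>" for xs
  proof (cases "quad_var d xs \<le> 2")
    case True
    have "cmod (iexp (t * partial_sum d xs) * ?e - stopped_process t d xs) =
        \<bar>exp (t\<^sup>2 / 2) - exp (t\<^sup>2 / 2 * quad_var d xs)\<bar>"
      unfolding stopped_process_eq[OF True] exp_process_def right_diff_distrib[symmetric] norm_mult
        of_real_diff[symmetric] norm_of_real by simp
    also have "\<dots> \<le> exp (t\<^sup>2) * \<bar>t\<^sup>2 / 2 - t\<^sup>2 / 2 * quad_var d xs\<bar>"
      using mult_left_mono[OF True, of "t\<^sup>2 / 2"] by (intro abs_exp_diff_le) auto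
    also have "\<bar>t\<^sup>2 / 2 - t\<^sup>2 / 2 * quad_var d xs\<bar> = t\<^sup>2 / 2 * \<bar>quad_var d xs - 1\<bar>"
    proof -
      have "t\<^sup>2 / 2 - t\<^sup>2 / 2 * quad_var d xs = t\<^sup>2 / 2 * (1 - quad_var d xs)" by (simp add: algebra_simps)
      then show ?thesis by (simp only: abs_mult) (simp add: abs_minus_commute)
    qed
    finally show ?thesis
      by (rule order_trans) (unfold mult.assoc, intro mult_left_mono mult_right_mono, auto)
  next
    case False
    have "cmod (iexp (t * partial_sum d xs) * ?e - stopped_process t d xs) \<le>
       exp (t\<^sup>2 / 2) + exp (t\<^sup>2)"
      using norm_stopped_process[of t d xs]
        norm_triangle_ineq4[of "iexp (t * partial_sum d xs) * ?e" "stopped_process t d xs"]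
      by (simp add: norm_mult)
    also have "\<dots> \<le> exp (t\<^sup>2) * 2 * 1" by simp
    also have "\<dots> \<le> exp (t\<^sup>2) * (2 + t\<^sup>2 / 2) * \<bar>quad_var d xs - 1\<bar>"
      using False by (intro mult_mono) auto
    finally show ?thesis .
  qed
  have "cmod (expect n (\<lambda>xs. iexp (t * partial_sum d xs)) * ?e - expect n (stopped_process t d)) \<le>
     (exp (t\<^sup>2) * (2 + t\<^sup>2 / 2)) * expect n (\<lambda>xs. \<bar>quad_var d xs - 1\<bar>)"
    unfolding expect_mult_right[symmetric] expect_mult_left[symmetric] expect_diff[symmetric]
    by (rule order_trans[OF norm_expect_le expect_mono[OF pw]])
  then have 1: "cmod (expect n (\<lambda>xs. iexp (t * partial_sum d xs)) * ?e - 1) \<le>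
    exp (t\<^sup>2) * ((\<Sum>l<n. expect l (lyapunov t d)) + t ^ 4 / 8 * (\<Sum>l<n. expect l (\<lambda>xs. (cond_var d xs)\<^sup>2))
      + (2 + t\<^sup>2 / 2) * expect n (\<lambda>xs. \<bar>quad_var d xs - 1\<bar>))" (is "_ \<le> ?B")
  proof -
    have *: "(t\<^sup>2 / 2 * cond_var d xs)\<^sup>2 / 2 = t ^ 4 / 8 * (cond_var d xs)\<^sup>2" for xs
      by (simp add: power_mult_distrib power_divide flip: power_mult)
    show ?thesis
      using \<open>cmod (_ - expect n (stopped_process t d)) \<le> _\<close> expect_stopped_process[OF d, of n t]
        norm_triangle_ineq[of "expect n (\<lambda>xs. iexp (t * partial_sum d xs)) * ?e - expect n (stopped_process t d)"
          "expect n (stopped_process t d) - 1"]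
      unfolding * expect_add expect_mult_left sum.distrib sum_distrib_left[symmetric]
      by (simp add: algebra_simps)
  qed
  \<comment> \<open>Undoing the multiplication by \<open>?e\<close> costs nothing, as its inverse is
    at most 1.\<close>
  have "expect n (\<lambda>xs. iexp (t * partial_sum d xs)) - of_real (exp (- (t\<^sup>2) / 2)) =
    (expect n (\<lambda>xs. iexp (t * partial_sum d xs)) * ?e - 1) * of_real (exp (- (t\<^sup>2) / 2))"
    by (simp add: left_diff_distrib mult.assoc flip: of_real_mult exp_add)
  also have "cmod \<dots> \<le> ?B * 1"
    unfolding norm_mult by (intro mult_mono 1 order_trans[OF norm_ge_zero 1]) auto
  finally show ?thesis by simp
qed

end

section \<open>The degenerate kernel of the chi-square statistic\<close>

context finite_law
begin

lemma p_le_1: "x \<in> A \<Longrightarrow> p x \<le> 1"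
  using member_le_sum[of x A p] finite_A p_pos sum_p by (auto intro: less_imp_le)

lemma inverse_p_ge_1: "x \<in> A \<Longrightarrow> 1 / p x \<ge> 1"
  using p_le_1[of x] p_pos[of x] by simp

lemma card_A_pos: "card A \<ge> 1"
  using sum_p finite_A by (cases "A = {}") (auto simp: Suc_le_eq card_gt_0_iff)

lemma partial_sum_scale: "partial_sum (\<lambda>x xs. c * d x xs) xs = c * partial_sum d xs"
  by (induction xs) (auto simp: algebra_simps)

lemma cond_var_scale: "cond_var (\<lambda>x xs. c * d x xs) xs = c\<^sup>2 * cond_var d xs"
  by (simp add: cond_var_def sum_distrib_left power_mult_distrib mult.left_commute)

lemma martingale_diff_scale: "martingale_diff d \<Longrightarrow> martingale_diff (\<lambda>x xs. c * d x xs)"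
  unfolding martingale_diff_def
  by (simp add: mult.left_commute[of _ c] flip: sum_distrib_left)

lemma cond_var_iid: "cond_var (\<lambda>x _. f x) = (\<lambda>_. \<Sum>x\<in>A. p x * (f x)\<^sup>2)"
  by (simp add: cond_var_def fun_eq_iff)

lemma expect_abs_partial_sum:
  "expect n (\<lambda>xs. \<bar>partial_sum (\<lambda>_. f) xs\<bar>) \<le> (\<Sum>l<n. expect l (\<lambda>xs. \<bar>f xs\<bar>))"
proof -
  have "\<bar>partial_sum (\<lambda>_. f) xs\<bar> \<le> partial_sum (\<lambda>_ xs. \<bar>f xs\<bar>) xs" for xs
    by (induction xs) auto
  then have "expect n (\<lambda>xs. \<bar>partial_sum (\<lambda>_. f) xs\<bar>) \<le> expect n (partial_sum (\<lambda>_ xs. \<bar>f xs\<bar>))"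
    by (rule expect_mono)
  then show ?thesis
    by (simp add: expect_partial_sum sum_p flip: sum_distrib_right)
qed

text \<open>The term linear in the new value vanishes because f has mean zero, the cubic one because
  the partial sum has. With mu_k the k-th moment of f, the step from n adds 6 n mu_2^2 + mu_4, and 3
  (n+1)^2 - 3 n^2 \<ge> 6 n accounts for the constant 3.\<close>

lemma expect_iid_sum_fourth:
  assumes f: "(\<Sum>x\<in>A. p x * f x) = 0"
  shows "expect n (\<lambda>xs. (partial_sum (\<lambda>x _. f x) xs) ^ 4)
    \<le> real n * (\<Sum>x\<in>A. p x * f x ^ 4) + 3 * (real n)\<^sup>2 * (\<Sum>x\<in>A. p x * (f x)\<^sup>2)\<^sup>2"
proof (induction n)
  case (Suc n)
  let ?S = "partial_sum (\<lambda>x _. f x)"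
  let ?\<mu> = "\<lambda>k. \<Sum>x\<in>A. p x * f x ^ k"
  have mg: "martingale_diff (\<lambda>x _. f x)" using f by (simp add: martingale_diff_def)
  have "(a + b) ^ 4 = a ^ 4 + 4 * a ^ 3 * b + 6 * a\<^sup>2 * b\<^sup>2 + 4 * a * b ^ 3 + b ^ 4" for a b :: real
    by (simp add: eval_nat_numeral algebra_simps)
  then have "expect (Suc n) (\<lambda>xs. (?S xs) ^ 4) =
      expect n (\<lambda>xs. (?S xs) ^ 4 * (\<Sum>x\<in>A. p x) + 4 * (?S xs) ^ 3 * (\<Sum>x\<in>A. p x * f x)
        + 6 * (?S xs)\<^sup>2 * ?\<mu> 2 + 4 * ?S xs * ?\<mu> 3 + ?\<mu> 4)"
    unfolding expect_Suc sum_distrib_left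
    by (simp add: ring_distribs sum.distrib mult.assoc mult.left_commute mult.commute)
  also have "\<dots> = expect n (\<lambda>xs. (?S xs) ^ 4) + 6 * ?\<mu> 2 * expect n (\<lambda>xs. (?S xs)\<^sup>2)
      + 4 * ?\<mu> 3 * expect n ?S + ?\<mu> 4"
    unfolding sum_p f expect_add expect_const mult.assoc expect_mult_left expect_mult_right by simp
  also have "expect n ?S = 0"
    by (simp add: expect_partial_sum f expect_const)
  also have "expect n (\<lambda>xs. (?S xs)\<^sup>2) = real n * ?\<mu> 2"
    unfolding expect_partial_sum_sq[OF mg] by (simp add: cond_var_iid expect_const)
  finally have "expect (Suc n) (\<lambda>xs. (?S xs) ^ 4) =
    expect n (\<lambda>xs. (?S xs) ^ 4) + 6 * real n * (?\<mu> 2)\<^sup>2 + ?\<mu> 4"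
    by (simp add: power2_eq_square)
  moreover have "3 * (real (Suc n))\<^sup>2 * (?\<mu> 2)\<^sup>2 =
      3 * (real n)\<^sup>2 * (?\<mu> 2)\<^sup>2 + 6 * real n * (?\<mu> 2)\<^sup>2 + 3 * (?\<mu> 2)\<^sup>2"
    by (simp add: power2_eq_square[of "1 + real n"] power2_eq_square[of "real n"] algebra_simps)
  moreover have "real (Suc n) * ?\<mu> 4 = real n * ?\<mu> 4 + ?\<mu> 4"
    by (simp add: algebra_simps)
  ultimately show ?case using Suc zero_le_power2[of "?\<mu> 2"] by linarith
qed simp

text \<open>The kernel of the orthogonal projection of $L^2(p)$ onto the mean-zero functions; being a
  projection, it reproduces itself under composition, which is what makes the conditional
  variances below explicit.\<close>

definition kernel :: "'a \<Rightarrow> 'a \<Rightarrow> real" where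
  "kernel x y = (if x = y then 1 / p x else 0) - 1"

lemma kernel_commute: "kernel x y = kernel y x"
  by (simp add: kernel_def)

lemma p_mult_kernel: "x \<in> A \<Longrightarrow> p x * kernel x y = (if x = y then 1 else 0) - p x"
  using p_pos[of x] by (auto simp: kernel_def right_diff_distrib)

lemma sum_kernel: "y \<in> A \<Longrightarrow> (\<Sum>x\<in>A. p x * kernel x y) = 0"
  by (simp add: p_mult_kernel sum_subtractf finite_A sum_p cong: sum.cong)

text \<open>The projection written out: it subtracts the mean. A function of mean zero is returned
  unchanged, which collapses the cross terms and the squared kernel in
  \<open>cond_var_col_sum\<close>.\<close>

lemma sum_kernel_mult:
  "y \<in> A \<Longrightarrow> (\<Sum>x\<in>A. p x * kernel x y * f x) = f y - (\<Sum>x\<in>A. p x * f x)"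
proof -
  assume y: "y \<in> A"
  have "(\<Sum>x\<in>A. p x * kernel x y * f x) = (\<Sum>x\<in>A. (if x = y then f x else 0) - p x * f x)"
    by (rule sum.cong) (auto simp: p_mult_kernel left_diff_distrib)
  then show ?thesis using y by (simp add: sum_subtractf finite_A)
qed

text \<open>The increment of the pair sum when \<open>x\<close> arrives after \<open>xs\<close>. For
  fixed \<open>x\<close> it is itself an iid sum over the past, with explicit moments.\<close>

definition col_sum :: "'a \<Rightarrow> 'a list \<Rightarrow> real" where
  "col_sum x = partial_sum (\<lambda>y _. kernel x y)"

lemma col_sum_simps [simp]:
  "col_sum x [] = 0" "col_sum x (y # xs) = col_sum x xs + kernel x y"
  by (simp_all add: col_sum_def)

lemma martingale_diff_col_sum: "martingale_diff col_sum"
  unfolding martingale_diff_def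
proof safe
  fix xs assume "set xs \<subseteq> A"
  then show "(\<Sum>x\<in>A. p x * col_sum x xs) = 0"
    by (induction xs) (auto simp: ring_distribs sum.distrib sum_kernel)
qed

abbreviation pair_sum :: "'a list \<Rightarrow> real" where
  "pair_sum \<equiv> partial_sum col_sum"

abbreviation diag_sum :: "'a list \<Rightarrow> real" where
  "diag_sum \<equiv> partial_sum (\<lambda>x _. 1 / p x - card A)"

text \<open>The variance of 1/p(X), whose mean is \<open>card A\<close> by
  \<open>sum_p_inverse\<close>.\<close>

definition inv_var :: real where
  "inv_var = (\<Sum>x\<in>A. p x * (1 / p x - card A)\<^sup>2)"

lemma inv_var_nonneg: "inv_var \<ge> 0"
  unfolding inv_var_def using p_pos by (intro sum_nonneg mult_nonneg_nonneg) (auto intro: less_imp_le)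

lemma sum_p_inverse: "(\<Sum>x\<in>A. p x * (1 / p x)) = card A"
  using p_pos by (simp add: less_imp_neq[symmetric] cong: sum.cong)

lemma martingale_diff_diag: "martingale_diff (\<lambda>x _. 1 / p x - card A)"
  unfolding martingale_diff_def right_diff_distrib sum_subtractf sum_p_inverse
  by (simp add: sum_p flip: sum_distrib_right)

text \<open>When \<open>y\<close> is added, the cross term becomes \<open>col_sum y xs\<close>, the
  increment of \<open>pair_sum\<close>, and the square becomes 1/p(y) - 1, which splits into the
  increment of \<open>diag_sum\<close> and the constant \<open>card A\<close> - 1.\<close>

lemma cond_var_col_sum:
  "set xs \<subseteq> A \<Longrightarrow>
    cond_var col_sum xs = 2 * pair_sum xs + diag_sum xs + real (length xs) * (real (card A) - 1)"
proof (induction xs)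
  case (Cons y xs)
  then have y: "y \<in> A" and xs: "set xs \<subseteq> A" by auto
  have "cond_var col_sum (y # xs) = cond_var col_sum xs
      + 2 * (\<Sum>x\<in>A. p x * kernel x y * col_sum x xs) + (\<Sum>x\<in>A. p x * kernel x y * kernel x y)"
    unfolding cond_var_def sum_distrib_left sum.distrib[symmetric]
    by (rule sum.cong) (simp_all add: power2_eq_square algebra_simps)
  also have "(\<Sum>x\<in>A. p x * kernel x y * col_sum x xs) = col_sum y xs"
    using sum_kernel_mult[OF y] martingale_diffD[OF martingale_diff_col_sum xs] by simp
  also have "(\<Sum>x\<in>A. p x * kernel x y * kernel x y) = 1 / p y - 1"
    using sum_kernel_mult[OF y] sum_kernel[OF y] by (simp add: kernel_def)
  finally show ?case using Cons.IH[OF xs] by (simp add: algebra_simps)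
qed (simp add: cond_var_def)

lemma expect_diag_sum_sq: "expect n (\<lambda>xs. (diag_sum xs)\<^sup>2) = real n * inv_var"
  unfolding expect_partial_sum_sq[OF martingale_diff_diag]
  by (simp add: cond_var_iid expect_const inv_var_def)

lemma expect_martingale_zero: "martingale_diff d \<Longrightarrow> expect n (partial_sum d) = 0"
proof -
  assume d: "martingale_diff d"
  have "expect l (\<lambda>xs. \<Sum>x\<in>A. p x * d x xs) = expect l (\<lambda>_. 0)" for l
    by (rule expect_cong) (simp add: martingale_diffD[OF d] samplesD)
  then show ?thesis by (simp add: expect_partial_sum expect_const)
qed

lemma samples_length: "xs \<in> samples n \<Longrightarrow> length xs = n"
  by (simp add: samples_def)

text \<open>Both random parts of \<open>cond_var_col_sum\<close> have mean zero, so the step after l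
  observations contributes l (m - 1). Only the order n sqrt m of the pair sum matters later.\<close>

lemma expect_pair_sum_sq:
  "expect n (\<lambda>xs. (pair_sum xs)\<^sup>2) \<le> (real n)\<^sup>2 * card A"
proof -
  have "expect l (cond_var col_sum) = real l * (real (card A) - 1)" for l
  proof -
    have "expect l (cond_var col_sum) =
        expect l (\<lambda>xs. 2 * pair_sum xs + diag_sum xs + real l * (real (card A) - 1))"
      by (rule expect_cong) (simp add: cond_var_col_sum samplesD samples_length)
    then show ?thesis
      unfolding expect_add expect_const expect_mult_left expect_martingale_zero[OF martingale_diff_diag]
        expect_martingale_zero[OF martingale_diff_col_sum] by simp
  qed
  then have "expect n (\<lambda>xs. (pair_sum xs)\<^sup>2) = (\<Sum>l<n. real l * (real (card A) - 1))"
    by (simp add: expect_partial_sum_sq[OF martingale_diff_col_sum])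
  also have "\<dots> \<le> (\<Sum>l<n. real n * card A)"
    using card_A_pos by (intro sum_mono mult_mono) auto
  finally show ?thesis by (simp add: power2_eq_square)
qed

lemma abs_kernel_le: "x \<in> A \<Longrightarrow> \<bar>kernel x y\<bar> \<le> 1 / p x"
  using inverse_p_ge_1[of x] by (auto simp: kernel_def abs_if)

text \<open>For fixed \<open>x\<close> this is an iid sum with step variance 1/p(x) - 1. The fourth
  moment of a step is at most this variance times the square of the uniform bound 1/p(x), hence the
  cube.\<close>

lemma
  assumes x: "x \<in> A"
  shows expect_col_sum_sq: "expect n (\<lambda>xs. (col_sum x xs)\<^sup>2) \<le> real n / p x"
    and expect_col_sum_fourth: "expect n (\<lambda>xs. (col_sum x xs) ^ 4)
      \<le> real n * (1 / p x) ^ 3 + 3 * (real n)\<^sup>2 * (1 / p x)\<^sup>2"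
proof -
  have w: "1 / p x \<ge> 1" using x by (rule inverse_p_ge_1)
  have 1: "(\<Sum>y\<in>A. p y * kernel x y) = 0"
    using sum_kernel[OF x] by (simp add: kernel_commute)
  have "(\<Sum>y\<in>A. p y * kernel y x * kernel y x) = 1 / p x - 1"
    using sum_kernel_mult[OF x] sum_kernel[OF x] by (simp add: kernel_def)
  then have 2: "(\<Sum>y\<in>A. p y * (kernel x y)\<^sup>2) = 1 / p x - 1"
    by (simp add: kernel_commute[of x] power2_eq_square mult.assoc)
  have mg: "martingale_diff (\<lambda>y _. kernel x y)" using 1 by (simp add: martingale_diff_def)
  have "expect n (\<lambda>xs. (col_sum x xs)\<^sup>2) = real n * (1 / p x - 1)"
    unfolding col_sum_def expect_partial_sum_sq[OF mg] by (simp add: cond_var_iid 2 expect_const)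
  then show "expect n (\<lambda>xs. (col_sum x xs)\<^sup>2) \<le> real n / p x"
    by (simp add: algebra_simps)
  have "(\<Sum>y\<in>A. p y * kernel x y ^ 4) \<le> (\<Sum>y\<in>A. (1 / p x)\<^sup>2 * (p y * (kernel x y)\<^sup>2))"
  proof (rule sum_mono)
    fix y assume y: "y \<in> A"
    have "p y * kernel x y ^ 4 = (kernel x y)\<^sup>2 * (p y * (kernel x y)\<^sup>2)"
      by (simp add: eval_nat_numeral)
    also have "\<dots> \<le> (1 / p x)\<^sup>2 * (p y * (kernel x y)\<^sup>2)"
      using abs_kernel_le[OF x, of y] p_pos[OF y] p_pos[OF x]
      by (intro mult_right_mono) (auto simp: abs_le_square_iff[symmetric])
    finally show "p y * kernel x y ^ 4 \<le> (1 / p x)\<^sup>2 * (p y * (kernel x y)\<^sup>2)" .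
  qed
  also have "\<dots> = (1 / p x)\<^sup>2 * (1 / p x - 1)"
    by (simp add: 2 flip: sum_distrib_left)
  also have "\<dots> \<le> (1 / p x)\<^sup>2 * (1 / p x)"
    by (intro mult_left_mono) auto
  finally have 4: "(\<Sum>y\<in>A. p y * kernel x y ^ 4) \<le> (1 / p x) ^ 3"
    by (simp add: eval_nat_numeral)
  have "expect n (\<lambda>xs. (col_sum x xs) ^ 4) \<le>
      real n * (\<Sum>y\<in>A. p y * kernel x y ^ 4) + 3 * (real n)\<^sup>2 * (1 / p x - 1)\<^sup>2"
    unfolding col_sum_def 2[symmetric] by (rule expect_iid_sum_fourth[OF 1])
  also have "\<dots> \<le> real n * (1 / p x) ^ 3 + 3 * (real n)\<^sup>2 * (1 / p x)\<^sup>2"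
    using w 4 by (intro add_mono mult_left_mono power_mono) auto
  finally show "expect n (\<lambda>xs. (col_sum x xs) ^ 4)
      \<le> real n * (1 / p x) ^ 3 + 3 * (real n)\<^sup>2 * (1 / p x)\<^sup>2" .
qed

end

text \<open>Truncation at |u| = e: below it the cube is at most e u^2, above it u^2 is at most
  u^4/e^2. A third absolute moment is thus traded for even moments, which can be bounded for iid
  sums.\<close>

lemma min_sq_cube_le:
  fixes u e :: real
  assumes "e > 0"
  shows "min (u\<^sup>2) (\<bar>u\<bar> ^ 3 / 6) \<le> e * u\<^sup>2 + min (u\<^sup>2) (u ^ 4 / e\<^sup>2)"
proof (cases "\<bar>u\<bar> \<le> e")
  case True
  have "\<bar>u\<bar> ^ 3 = \<bar>u\<bar> * u\<^sup>2" by (simp add: power3_eq_cube power2_eq_square)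
  moreover have "0 \<le> \<bar>u\<bar> * u\<^sup>2" by simp
  ultimately have "\<bar>u\<bar> ^ 3 / 6 \<le> \<bar>u\<bar> * u\<^sup>2" by linarith
  also have "\<dots> \<le> e * u\<^sup>2" using True by (intro mult_right_mono) auto
  finally have "\<bar>u\<bar> ^ 3 / 6 \<le> e * u\<^sup>2" .
  moreover have "0 \<le> min (u\<^sup>2) (u ^ 4 / e\<^sup>2)" by simp
  ultimately show ?thesis by linarith
next
  case False
  then have "e\<^sup>2 \<le> u\<^sup>2" using assms by (auto simp: abs_le_square_iff[symmetric])
  then have "u\<^sup>2 * e\<^sup>2 \<le> u\<^sup>2 * u\<^sup>2" by (intro mult_left_mono) auto
  then have "u\<^sup>2 \<le> u ^ 4 / e\<^sup>2"
    using assms by (simp add: pos_le_divide_eq eval_nat_numeral mult.assoc)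
  then have "min (u\<^sup>2) (u ^ 4 / e\<^sup>2) = u\<^sup>2" by (rule min_absorb1)
  moreover have "0 \<le> e * u\<^sup>2" using assms by simp
  ultimately show ?thesis using min.cobounded1[of "u\<^sup>2" "\<bar>u\<bar> ^ 3 / 6"] by linarith
qed

section \<open>The Lyapunov sum of the normalised pair sum\<close>

context finite_law
begin

text \<open>The moment of order 1 + \<delta> of y = 1/(m p(X)), which has mean one. Its boundedness
  in n is the moment hypothesis.\<close>

definition inv_moment :: "real \<Rightarrow> real" where
  "inv_moment \<delta> = (\<Sum>x\<in>A. p x * (1 / (p x * card A)) powr (1 + \<delta>))"

text \<open>Given the newest observation, the second moment of the increment is at most a = 2 t^2
  y/n and the truncated fourth-moment term at most a b, so the minimum has mean at most a min(1, b).
  L plays two roles: 1/L truncates the increment and L cuts off y. The factor n anticipates the sum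
  over n steps.\<close>

lemma expect_lyapunov:
  fixes L :: real
  assumes l: "l \<le> n" and n: "n \<ge> 1" and L: "L > 0" and \<delta>: "\<delta> > 0"
    and c: "c\<^sup>2 = 2 / ((real n)\<^sup>2 * card A)"
  shows "real n * expect l (lyapunov t (\<lambda>x xs. c * col_sum x xs)) \<le>
    2 * t\<^sup>2 / L + 2 * t\<^sup>2 * (2 * t\<^sup>2 * (L ^ 5 * card A / (real n)\<^sup>2 + 3 * L ^ 4 / n)
      + L powr (- \<delta>) * inv_moment \<delta>)"
proof -
  let ?m = "real (card A)"
  define y where "y x = 1 / (p x * ?m)" for x
  define K where "K = 2 * t\<^sup>2 * (L ^ 5 * ?m / (real n)\<^sup>2 + 3 * L ^ 4 / n)"
  have m: "?m > 0" using card_A_pos by simp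
  have n': "real n > 0" using n by simp
  have main: "real n * expect l (\<lambda>xs. min ((t * (c * col_sum x xs))\<^sup>2) (\<bar>t * (c * col_sum x xs)\<bar> ^ 3 / 6))
    \<le> 2 * t\<^sup>2 / L * y x + 2 * t\<^sup>2 * (K + L powr (- \<delta>) * y x powr (1 + \<delta>))" (is "_ * expect l ?f \<le> _")
    if x: "x \<in> A" for x
  proof -
    have y: "y x > 0" using p_pos[OF x] m by (simp add: y_def)
    have px: "1 / p x = ?m * y x" using p_pos[OF x] m by (simp add: y_def)
    let ?u = "\<lambda>xs. t * (c * col_sum x xs)"
    let ?a = "2 * t\<^sup>2 * y x / n"
    \<comment> \<open>The fourth-moment bound divided by the second-moment bound \<open>?a\<close>;
      the factor L^2 comes from truncating at 1/L.\<close>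
    define b where "b = 2 * t\<^sup>2 * L\<^sup>2 * (?m * (y x)\<^sup>2 / (real n)\<^sup>2 + 3 * y x / n)"
    have c4: "c ^ 4 = 4 / ((real n) ^ 4 * ?m\<^sup>2)"
    proof -
      have "c ^ 4 = (c\<^sup>2)\<^sup>2" by simp
      then show ?thesis unfolding c by (simp add: power_divide power_mult_distrib)
    qed
    have e2: "expect l (\<lambda>xs. (?u xs)\<^sup>2) \<le> ?a"
    proof -
      have "expect l (\<lambda>xs. (?u xs)\<^sup>2) = t\<^sup>2 * c\<^sup>2 * expect l (\<lambda>xs. (col_sum x xs)\<^sup>2)"
        by (simp add: power_mult_distrib expect_mult_left mult.assoc)
      also have "\<dots> \<le> t\<^sup>2 * c\<^sup>2 * (real n * (1 / p x))"
      proof (intro mult_left_mono order_trans[OF expect_col_sum_sq[OF x]])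
        show "real l / p x \<le> real n * (1 / p x)" using l p_pos[OF x] by (simp add: divide_right_mono)
      qed auto
      also have "\<dots> = ?a" unfolding px c using n' m by (simp add: field_simps power2_eq_square)
      finally show ?thesis .
    qed
    have e4: "expect l (\<lambda>xs. (?u xs) ^ 4 / (1 / L)\<^sup>2) \<le> ?a * b"
    proof -
      have "expect l (\<lambda>xs. (?u xs) ^ 4 / (1 / L)\<^sup>2) = t ^ 4 * c ^ 4 * L\<^sup>2 * expect l (\<lambda>xs. (col_sum x xs) ^ 4)"
        unfolding expect_mult_left[symmetric] by (simp add: power_mult_distrib power_divide mult_ac)
      also have "\<dots> \<le> t ^ 4 * c ^ 4 * L\<^sup>2 * (real n * (1 / p x) ^ 3 + 3 * (real n)\<^sup>2 * (1 / p x)\<^sup>2)"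
      proof (intro mult_left_mono order_trans[OF expect_col_sum_fourth[OF x]] add_mono mult_right_mono power_mono)
      qed (use l p_pos[OF x] in auto)
      also have "\<dots> = ?a * b"
        unfolding px c4 b_def using n' m by (simp add: field_simps eval_nat_numeral)
      finally show ?thesis .
    qed
    have "expect l ?f \<le> expect l (\<lambda>xs. 1 / L * (?u xs)\<^sup>2 + min ((?u xs)\<^sup>2) ((?u xs) ^ 4 / (1 / L)\<^sup>2))"
      using L by (intro expect_mono min_sq_cube_le) simp
    also have "\<dots> = 1 / L * expect l (\<lambda>xs. (?u xs)\<^sup>2) + expect l (\<lambda>xs. min ((?u xs)\<^sup>2) ((?u xs) ^ 4 / (1 / L)\<^sup>2))"
      unfolding expect_add expect_mult_left ..
    also have "\<dots> \<le> 1 / L * ?a + min ?a (?a * b)"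
    proof (intro add_mono mult_left_mono e2 min.boundedI)
      show "expect l (\<lambda>xs. min ((?u xs)\<^sup>2) ((?u xs) ^ 4 / (1 / L)\<^sup>2)) \<le> ?a"
        by (rule order_trans[OF expect_mono e2]) simp
      show "expect l (\<lambda>xs. min ((?u xs)\<^sup>2) ((?u xs) ^ 4 / (1 / L)\<^sup>2)) \<le> ?a * b"
        by (rule order_trans[OF expect_mono e4]) simp
    qed (use L in auto)
    finally have "real n * expect l ?f \<le> real n * (1 / L * ?a + min ?a (?a * b))"
      using n' by (intro mult_left_mono) auto
    also have "\<dots> = 2 * t\<^sup>2 / L * y x + 2 * t\<^sup>2 * (y x * min 1 b)"
    proof -
      have "min ?a (?a * b) = ?a * min 1 b"
        using y n' by (subst min_mult_distrib_left) auto
      then show ?thesis using n' by (simp add: field_simps)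
    qed
    \<comment> \<open>For y \<le> L, monotonicity allows y to be replaced by L, which gives
      \<open>K\<close>. For y > L, \<open>b\<close> is dropped and uniform integrability takes the
      form y \<le> L^(-\<delta>) y^(1+\<delta>).\<close>
    also have "y x * min 1 b \<le> K + L powr (- \<delta>) * y x powr (1 + \<delta>)"
    proof (cases "y x \<le> L")
      case True
      have "y x * min 1 b \<le> L * (2 * t\<^sup>2 * L\<^sup>2 * (?m * L\<^sup>2 / (real n)\<^sup>2 + 3 * L / n))"
      proof (rule mult_mono[OF True])
        have "b \<le> 2 * t\<^sup>2 * L\<^sup>2 * (?m * L\<^sup>2 / (real n)\<^sup>2 + 3 * L / n)"
          unfolding b_def using True y by (intro mult_left_mono add_mono divide_right_mono power_mono) auto
        then show "min 1 b \<le> 2 * t\<^sup>2 * L\<^sup>2 * (?m * L\<^sup>2 / (real n)\<^sup>2 + 3 * L / n)" by simp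
        show "0 \<le> min 1 b" using y by (simp add: b_def)
      qed (use L in auto)
      also have "\<dots> = K" unfolding K_def by (simp add: algebra_simps eval_nat_numeral)
      finally show ?thesis by (simp add: add_increasing2)
    next
      case False
      have "y x * min 1 b \<le> y x" using y by (simp add: mult_left_le)
      also have "\<dots> = L powr (- \<delta>) * (L powr \<delta> * y x)"
        using L by (simp add: powr_minus)
      also have "\<dots> \<le> L powr (- \<delta>) * (y x powr \<delta> * y x)"
        using False L \<delta> y by (intro mult_left_mono mult_right_mono powr_mono2) auto
      also have "y x powr \<delta> * y x = y x powr (1 + \<delta>)"
        using y by (simp add: powr_add)
      finally have "y x * min 1 b \<le> L powr (- \<delta>) * y x powr (1 + \<delta>)" .
      moreover have "K \<ge> 0" using L by (simp add: K_def)
      ultimately show ?thesis by linarith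
    qed
    finally show ?thesis by (simp add: mult_left_mono)
  qed
  have "real n * expect l (lyapunov t (\<lambda>x xs. c * col_sum x xs)) =
    (\<Sum>x\<in>A. p x * (real n * expect l (\<lambda>xs. min ((t * (c * col_sum x xs))\<^sup>2) (\<bar>t * (c * col_sum x xs)\<bar> ^ 3 / 6))))"
    unfolding lyapunov_def expect_sum expect_mult_left sum_distrib_left by (simp add: mult.left_commute)
  also have "\<dots> \<le> (\<Sum>x\<in>A. p x * (2 * t\<^sup>2 / L * y x + 2 * t\<^sup>2 * (K + L powr (- \<delta>) * y x powr (1 + \<delta>))))"
    using main p_pos by (intro sum_mono mult_left_mono) (auto intro: less_imp_le)
  also have "\<dots> = 2 * t\<^sup>2 / L * (\<Sum>x\<in>A. p x * y x) + 2 * t\<^sup>2 * (K * (\<Sum>x\<in>A. p x) + L powr (- \<delta>) * inv_moment \<delta>)"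
    unfolding inv_moment_def y_def[symmetric] by (simp add: algebra_simps sum.distrib sum_distrib_left sum_divide_distrib)
  also have "(\<Sum>x\<in>A. p x * y x) = (\<Sum>x\<in>A. p x * (1 / p x)) / ?m"
    unfolding y_def sum_divide_distrib by (rule sum.cong) simp_all
  also have "\<dots> = 1" unfolding sum_p_inverse using m by simp
  finally show ?thesis by (simp add: K_def sum_p)
qed

end

text \<open>Lets the diagonal part and the constant shift of the statistic be discarded at the price
  of their mean absolute size.\<close>

lemma norm_iexp_diff_le: "cmod (iexp a - iexp b) \<le> \<bar>a - b\<bar>" for a b :: real
proof -
  have "iexp a = iexp b * iexp (a - b)"
    unfolding exp_add[symmetric] by (simp add: algebra_simps)
  then have "iexp a - iexp b = iexp b * (iexp (a - b) - 1)"
    by (simp add: right_diff_distrib)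
  then have "cmod (iexp a - iexp b) = cmod (iexp (a - b) - 1)"
    by (simp only: norm_mult norm_exp_i_times)
  also have "\<dots> \<le> \<bar>a - b\<bar>"
    using iexp_approx1[of "a - b" 0] by simp
  finally show ?thesis .
qed

section \<open>Quadratic variation and characteristic function of the pair sum\<close>

context finite_law
begin

lemma expect_cond_var_sq:
  assumes l: "l \<le> n"
  shows "expect l (\<lambda>xs. (cond_var col_sum xs)\<^sup>2) \<le>
    3 * (4 * (real n)\<^sup>2 * card A + real n * inv_var + (real n)\<^sup>2 * (real (card A))\<^sup>2)"
proof -
  let ?k = "real l * (real (card A) - 1)"
  have sq: "(a + b + c)\<^sup>2 \<le> 3 * (a\<^sup>2 + b\<^sup>2 + c\<^sup>2)" for a b c :: real
    using sum_squares_ge_zero[of "a - b" "b - c"] zero_le_power2[of "a - c"]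
    by (simp add: power2_eq_square algebra_simps)
  have "expect l (\<lambda>xs. (cond_var col_sum xs)\<^sup>2) \<le>
      expect l (\<lambda>xs. 3 * (4 * (pair_sum xs)\<^sup>2 + (diag_sum xs)\<^sup>2 + ?k\<^sup>2))"
  proof (rule expect_mono)
    fix xs assume "xs \<in> samples l"
    then show "(cond_var col_sum xs)\<^sup>2 \<le> 3 * (4 * (pair_sum xs)\<^sup>2 + (diag_sum xs)\<^sup>2 + ?k\<^sup>2)"
      using sq[of "2 * pair_sum xs" "diag_sum xs" ?k]
      by (simp add: cond_var_col_sum samplesD samples_length power_mult_distrib)
  qed
  also have "\<dots> = 3 * (4 * expect l (\<lambda>xs. (pair_sum xs)\<^sup>2) + real l * inv_var + ?k\<^sup>2)"
    by (simp only: expect_mult_left expect_add expect_const expect_diag_sum_sq)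
  also have "\<dots> \<le> 3 * (4 * ((real n)\<^sup>2 * card A) + real n * inv_var + (real n * real (card A))\<^sup>2)"
    using l card_A_pos inv_var_nonneg
    by (intro mult_left_mono add_mono order_trans[OF expect_pair_sum_sq] power_mono mult_mono) auto
  finally show ?thesis by (simp add: power_mult_distrib mult.assoc)
qed

text \<open>The increment after l observations has the deterministic part l (m - 1), with l running
  from 0 to one less than the length; this gives the triangular number. The rest is centred.\<close>

lemma quad_var_col_sum:
  "set xs \<subseteq> A \<Longrightarrow> quad_var col_sum xs = partial_sum (\<lambda>_ ys. 2 * pair_sum ys + diag_sum ys) xs
    + (real (card A) - 1) * (real (length xs) * (real (length xs) - 1) / 2)"
  by (induction xs) (auto simp: cond_var_col_sum field_simps)

lemma expect_abs_pair_sum: "expect l (\<lambda>xs. \<bar>pair_sum xs\<bar>) \<le> real l * sqrt (card A)"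
proof -
  have "expect l (\<lambda>xs. \<bar>pair_sum xs\<bar>) \<le> sqrt ((real l)\<^sup>2 * card A)"
    by (rule order_trans[OF expect_abs_le_sqrt]) (simp add: expect_pair_sum_sq)
  then show ?thesis by (simp add: real_sqrt_mult)
qed

lemma expect_abs_diag_sum: "expect l (\<lambda>xs. \<bar>diag_sum xs\<bar>) \<le> sqrt (real l * inv_var)"
  by (rule order_trans[OF expect_abs_le_sqrt]) (simp add: expect_diag_sum_sq)

lemma expect_quad_var:
  assumes n: "n \<ge> 1" and c: "c\<^sup>2 = 2 / ((real n)\<^sup>2 * card A)"
  shows "expect n (\<lambda>xs. \<bar>c\<^sup>2 * quad_var col_sum xs - 1\<bar>) \<le>
    2 / (real n * card A) * (2 * (real n * sqrt (card A)) + sqrt (real n * inv_var))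
      + 1 / card A + 1 / real n"
proof -
  let ?m = "real (card A)" and ?F = "\<lambda>ys. 2 * pair_sum ys + diag_sum ys"
  have m: "?m \<ge> 1" using card_A_pos by simp
  have n': "real n \<ge> 1" using n by simp
  \<comment> \<open>Normalised, the deterministic part is (1 - 1/m)(1 - 1/n). The value of
    \<open>c\<^sup>2\<close> is chosen to make this tend to 1 as m and n grow.\<close>
  have k: "c\<^sup>2 * ((?m - 1) * (real n * (real n - 1) / 2)) - 1 = 1 / ?m * (1 / n) - 1 / ?m - 1 / n"
    unfolding c using n' m by (simp add: field_simps power2_eq_square)
  have "1 / ?m * (1 / n) \<le> 1 / ?m * 1" using n' m by (intro mult_left_mono) auto
  moreover have "0 \<le> 1 / ?m * (1 / n)" "0 \<le> 1 / real n" by simp_all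
  ultimately have k': "\<bar>1 / ?m * (1 / n) - 1 / ?m - 1 / n\<bar> \<le> 1 / ?m + 1 / n" by linarith
  have S: "expect n (\<lambda>xs. \<bar>partial_sum (\<lambda>_. ?F) xs\<bar>) \<le> real n * (2 * (real n * sqrt ?m) + sqrt (real n * inv_var))"
  proof -
    have "expect n (\<lambda>xs. \<bar>partial_sum (\<lambda>_. ?F) xs\<bar>) \<le> (\<Sum>l<n. expect l (\<lambda>xs. \<bar>?F xs\<bar>))"
      by (rule expect_abs_partial_sum)
    also have "\<dots> \<le> (\<Sum>l<n. 2 * (real n * sqrt ?m) + sqrt (real n * inv_var))"
    proof (rule sum_mono)
      fix l assume l: "l \<in> {..<n}"
      have "expect l (\<lambda>xs. \<bar>?F xs\<bar>) \<le> expect l (\<lambda>xs. 2 * \<bar>pair_sum xs\<bar> + \<bar>diag_sum xs\<bar>)"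
        by (rule expect_mono) (simp add: abs_triangle_ineq[THEN order_trans] abs_mult)
      also have "\<dots> = 2 * expect l (\<lambda>xs. \<bar>pair_sum xs\<bar>) + expect l (\<lambda>xs. \<bar>diag_sum xs\<bar>)"
        by (simp only: expect_add expect_mult_left)
      also have "\<dots> \<le> 2 * (real n * sqrt ?m) + sqrt (real n * inv_var)"
        using l inv_var_nonneg
        by (intro add_mono mult_left_mono order_trans[OF expect_abs_pair_sum]
            order_trans[OF expect_abs_diag_sum] mult_right_mono real_sqrt_le_mono) auto
      finally show "expect l (\<lambda>xs. \<bar>?F xs\<bar>) \<le> 2 * (real n * sqrt ?m) + sqrt (real n * inv_var)" .
    qed
    finally show ?thesis by simp
  qed
  have "expect n (\<lambda>xs. \<bar>c\<^sup>2 * quad_var col_sum xs - 1\<bar>) \<le>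
      expect n (\<lambda>xs. c\<^sup>2 * \<bar>partial_sum (\<lambda>_. ?F) xs\<bar> + (1 / ?m + 1 / n))"
  proof (rule expect_mono)
    fix xs assume "xs \<in> samples n"
    then have "c\<^sup>2 * quad_var col_sum xs - 1 =
        c\<^sup>2 * partial_sum (\<lambda>_. ?F) xs + (1 / ?m * (1 / n) - 1 / ?m - 1 / n)"
      unfolding k[symmetric] by (simp add: quad_var_col_sum samplesD samples_length distrib_left)
    then show "\<bar>c\<^sup>2 * quad_var col_sum xs - 1\<bar> \<le> c\<^sup>2 * \<bar>partial_sum (\<lambda>_. ?F) xs\<bar> + (1 / ?m + 1 / n)"
      using k' abs_triangle_ineq[of "c\<^sup>2 * partial_sum (\<lambda>_. ?F) xs" "1 / ?m * (1 / n) - 1 / ?m - 1 / n"]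
      by (simp only: abs_mult) simp
  qed
  also have "\<dots> = c\<^sup>2 * expect n (\<lambda>xs. \<bar>partial_sum (\<lambda>_. ?F) xs\<bar>) + (1 / ?m + 1 / n)"
    by (simp only: expect_add expect_mult_left expect_const)
  also have "\<dots> \<le> c\<^sup>2 * (real n * (2 * (real n * sqrt ?m) + sqrt (real n * inv_var))) + (1 / ?m + 1 / n)"
    by (intro add_mono mult_left_mono S) auto
  also have "\<dots> = 2 / (real n * ?m) * (2 * (real n * sqrt ?m) + sqrt (real n * inv_var)) + 1 / ?m + 1 / n"
    unfolding c using n' by (simp add: power2_eq_square)
  finally show ?thesis .
qed

lemma pair_sum_char_bound:
  fixes L :: real
  assumes n: "n \<ge> 1" and L: "L > 0" and \<delta>: "\<delta> > 0"
    and c: "c\<^sup>2 = 2 / ((real n)\<^sup>2 * card A)"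
  shows "cmod (expect n (\<lambda>xs. iexp (t * (c * pair_sum xs))) - of_real (exp (- (t\<^sup>2) / 2))) \<le>
    exp (t\<^sup>2) *
     ((2 * t\<^sup>2 / L + 2 * t\<^sup>2 * (2 * t\<^sup>2 * (L ^ 5 * card A / (real n)\<^sup>2 + 3 * L ^ 4 / n)
        + L powr (- \<delta>) * inv_moment \<delta>))
      + t ^ 4 / 8 * (12 * (4 / (real n * card A) + inv_var / (real n * card A)\<^sup>2 + 1 / n))
      + (2 + t\<^sup>2 / 2) * (2 / (real n * card A) * (2 * (real n * sqrt (card A)) + sqrt (real n * inv_var))
          + 1 / card A + 1 / n))"
proof -
  let ?m = "real (card A)" and ?d = "\<lambda>x xs. c * col_sum x xs"
  have m: "?m > 0" using card_A_pos by simp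
  have n': "real n > 0" using n by simp
  have ly: "(\<Sum>l<n. expect l (lyapunov t ?d)) \<le> 2 * t\<^sup>2 / L + 2 * t\<^sup>2 *
      (2 * t\<^sup>2 * (L ^ 5 * card A / (real n)\<^sup>2 + 3 * L ^ 4 / n) + L powr (- \<delta>) * inv_moment \<delta>)"
    (is "_ \<le> ?B")
  proof -
    have "expect l (lyapunov t ?d) \<le> ?B / n" if "l < n" for l
      using expect_lyapunov[OF less_imp_le[OF that] n L \<delta> c, of t] n'
      by (simp only: pos_le_divide_eq mult.commute)
    then have "(\<Sum>l<n. expect l (lyapunov t ?d)) \<le> (\<Sum>l<n. ?B / n)" by (intro sum_mono) simp
    then show ?thesis using n' by simp
  qed
  have cv: "(\<Sum>l<n. expect l (\<lambda>xs. (cond_var ?d xs)\<^sup>2)) \<le>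
      12 * (4 / (real n * ?m) + inv_var / (real n * ?m)\<^sup>2 + 1 / n)"
  proof -
    have "(\<Sum>l<n. expect l (\<lambda>xs. (cond_var ?d xs)\<^sup>2)) =
        (c\<^sup>2)\<^sup>2 * (\<Sum>l<n. expect l (\<lambda>xs. (cond_var col_sum xs)\<^sup>2))"
      by (simp only: cond_var_scale power_mult_distrib expect_mult_left sum_distrib_left)
    also have "\<dots> \<le> (c\<^sup>2)\<^sup>2 * (\<Sum>l<n. 3 * (4 * (real n)\<^sup>2 * ?m + real n * inv_var + (real n)\<^sup>2 * ?m\<^sup>2))"
      by (intro mult_left_mono sum_mono expect_cond_var_sq) auto
    also have "\<dots> = 12 * (4 / (real n * ?m) + inv_var / (real n * ?m)\<^sup>2 + 1 / n)"
      unfolding c using n' m by (simp add: field_simps power2_eq_square)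
    finally show ?thesis .
  qed
  have "cmod (expect n (\<lambda>xs. iexp (t * (c * pair_sum xs))) - of_real (exp (- (t\<^sup>2) / 2))) \<le>
    exp (t\<^sup>2) * ((\<Sum>l<n. expect l (lyapunov t ?d)) + t ^ 4 / 8 * (\<Sum>l<n. expect l (\<lambda>xs. (cond_var ?d xs)\<^sup>2))
      + (2 + t\<^sup>2 / 2) * expect n (\<lambda>xs. \<bar>c\<^sup>2 * quad_var col_sum xs - 1\<bar>))"
    using martingale_char_bound[OF martingale_diff_scale[OF martingale_diff_col_sum, of c], of n t]
    by (simp only: partial_sum_scale cond_var_scale[abs_def])
  also have "\<dots> \<le> exp (t\<^sup>2) * (?B + t ^ 4 / 8 * (12 * (4 / (real n * ?m) + inv_var / (real n * ?m)\<^sup>2 + 1 / n))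
      + (2 + t\<^sup>2 / 2) * (2 / (real n * ?m) * (2 * (real n * sqrt ?m) + sqrt (real n * inv_var))
          + 1 / ?m + 1 / n))"
    by (intro mult_left_mono add_mono ly cv expect_quad_var[OF n c]) (auto intro: add_nonneg_nonneg)
  finally show ?thesis .
qed

section \<open>From category counts to kernel sums\<close>

text \<open>The left side is the sum of \<open>kernel\<close> over all ordered pairs of
  observations, so each pair of distinct times counts twice. A new \<open>y\<close> changes a single
  count N, whose square grows by 2 N + 1.\<close>

lemma sum_count_sq:
  "set xs \<subseteq> A \<Longrightarrow> (\<Sum>x\<in>A. (real (count_list xs x))\<^sup>2 / p x) - (real (length xs))\<^sup>2 =
    2 * pair_sum xs + diag_sum xs + real (length xs) * (real (card A) - 1)"
proof (induction xs)
  case (Cons y xs)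
  then have y: "y \<in> A" and xs: "set xs \<subseteq> A" by auto
  have col: "col_sum y xs = real (count_list xs y) / p y - length xs"
    by (induction xs) (auto simp: kernel_def add_divide_distrib)
  have "(\<Sum>x\<in>A. (real (count_list (y # xs) x))\<^sup>2 / p x) =
      (\<Sum>x\<in>A. (real (count_list xs x))\<^sup>2 / p x + (if x = y then (2 * real (count_list xs x) + 1) / p x else 0))"
    by (rule sum.cong) (auto simp: power2_eq_square add_divide_distrib ring_distribs)
  also have "\<dots> = (\<Sum>x\<in>A. (real (count_list xs x))\<^sup>2 / p x) + (2 * real (count_list xs y) + 1) / p y"
    using y by (simp add: sum.distrib finite_A)
  finally show ?case
    using Cons.IH[OF xs] by (simp add: col power2_eq_square add_divide_distrib ring_distribs)
qed simp

definition chi2 :: "'a list \<Rightarrow> real" where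
  "chi2 xs = length xs * (\<Sum>x\<in>A. (1 / length xs * count_list xs x - p x)\<^sup>2 / p x)"

text \<open>When the square is opened, the last two terms sum to -2 n + n, as the counts add up to
  n. The natural centring is m - 1; centring at m leaves a shift by -1, which the scaling by sqrt(2
  m) makes negligible.\<close>

lemma chi2_eq:
  assumes xs: "set xs \<subseteq> A" and n: "length xs = n" "n \<ge> 1"
  shows "chi2 xs = (2 * pair_sum xs + diag_sum xs) / n + (real (card A) - 1)"
proof -
  have n': "real n > 0" using n by simp
  have cnt: "(\<Sum>x\<in>A. real (count_list xs x)) = n"
    unfolding of_nat_sum[symmetric] using sum_count_set[OF xs finite_A] n by simp
  have "chi2 xs = (\<Sum>x\<in>A. (real (count_list xs x))\<^sup>2 / p x / n - 2 * real (count_list xs x) + n * p x)"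
    unfolding chi2_def n(1) sum_distrib_left
  proof (rule sum.cong)
    fix x assume "x \<in> A"
    then show "n * ((1 / n * count_list xs x - p x)\<^sup>2 / p x) =
        (real (count_list xs x))\<^sup>2 / p x / n - 2 * real (count_list xs x) + n * p x"
      using p_pos[of x] n' by (simp add: field_simps power2_eq_square)
  qed simp
  also have "\<dots> = (\<Sum>x\<in>A. (real (count_list xs x))\<^sup>2 / p x) / n - 2 * n + n"
    unfolding sum.distrib sum_subtractf sum_divide_distrib[symmetric] sum_distrib_left[symmetric] cnt sum_p
    by simp
  also have "(\<Sum>x\<in>A. (real (count_list xs x))\<^sup>2 / p x) =
      (real n)\<^sup>2 + (2 * pair_sum xs + diag_sum xs + real n * (real (card A) - 1))"
    using sum_count_sq[OF xs] n by simp
  finally show ?thesis using n' by (simp add: field_simps power2_eq_square)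
qed

text \<open>The pair sum carries the limit. The normalised diagonal sum has mean absolute size at
  most sqrt(\<open>inv_var\<close> / (2 n m)), half the quantity in the variance condition under the
  root.\<close>

lemma chi2_char_bound:
  fixes L :: real
  assumes n: "n \<ge> 1" and L: "L > 0" and \<delta>: "\<delta> > 0"
  shows "cmod (expect n (\<lambda>xs. iexp (t * ((chi2 xs - card A) / sqrt (2 * real (card A)))))
      - of_real (exp (- (t\<^sup>2) / 2))) \<le>
    exp (t\<^sup>2) *
     ((2 * t\<^sup>2 / L + 2 * t\<^sup>2 * (2 * t\<^sup>2 * (L ^ 5 * card A / (real n)\<^sup>2 + 3 * L ^ 4 / n)
        + L powr (- \<delta>) * inv_moment \<delta>))
      + t ^ 4 / 8 * (12 * (4 / (real n * card A) + inv_var / (real n * card A)\<^sup>2 + 1 / n))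
      + (2 + t\<^sup>2 / 2) * (2 / (real n * card A) * (2 * (real n * sqrt (card A)) + sqrt (real n * inv_var))
          + 1 / card A + 1 / n))
    + \<bar>t\<bar> * (sqrt (real n * inv_var) / (n * sqrt (2 * real (card A))) + 1 / sqrt (2 * real (card A)))" (is "cmod (?E - ?e) \<le> ?B + ?R")
proof -
  let ?m = "real (card A)" and ?s = "sqrt (2 * real (card A))"
  \<comment> \<open>The coefficient of \<open>pair_sum\<close> in the normalised statistic.\<close>
  define c where "c = 2 / (n * ?s)"
  have m: "?m > 0" using card_A_pos by simp
  have n': "real n > 0" using n by simp
  have s: "?s > 0" using m by simp
  have c: "c\<^sup>2 = 2 / ((real n)\<^sup>2 * card A)"
    unfolding c_def using n' m by (simp add: power_divide power_mult_distrib)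
  have "cmod (?E - expect n (\<lambda>xs. iexp (t * (c * pair_sum xs)))) \<le> expect n (\<lambda>xs. cmod (iexp (t * ((chi2 xs - ?m) / ?s)) - iexp (t * (c * pair_sum xs))))"
    unfolding expect_diff[symmetric] by (rule norm_expect_le)
  also have "\<dots> \<le> expect n (\<lambda>xs. \<bar>t\<bar> * (1 / (n * ?s) * \<bar>diag_sum xs\<bar> + 1 / ?s))"
  proof (rule expect_mono)
    fix xs assume xs: "xs \<in> samples n"
    let ?a = "(chi2 xs - ?m) / ?s" and ?b = "c * pair_sum xs"
    have "chi2 xs - ?m = (2 * pair_sum xs + diag_sum xs) / n - 1"
      using chi2_eq[OF samplesD[OF xs] samples_length[OF xs] n] by simp
    then have ab: "?a - ?b = 1 / (n * ?s) * diag_sum xs - 1 / ?s"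
      by (simp add: c_def add_divide_distrib diff_divide_distrib)
    have "cmod (iexp (t * ?a) - iexp (t * ?b)) \<le> \<bar>t * ?a - t * ?b\<bar>"
      by (rule norm_iexp_diff_le)
    also have "\<dots> = \<bar>t\<bar> * \<bar>?a - ?b\<bar>"
      by (simp only: abs_mult flip: right_diff_distrib)
    also have "\<bar>?a - ?b\<bar> \<le> 1 / (n * ?s) * \<bar>diag_sum xs\<bar> + 1 / ?s"
      unfolding ab using s n' abs_triangle_ineq4[of "1 / (n * ?s) * diag_sum xs" "1 / ?s"]
      by (simp add: abs_mult)
    finally show "cmod (iexp (t * ?a) - iexp (t * ?b)) \<le> \<bar>t\<bar> * (1 / (n * ?s) * \<bar>diag_sum xs\<bar> + 1 / ?s)"
      by (simp add: mult_left_mono)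
  qed
  also have "\<dots> = \<bar>t\<bar> * (1 / (n * ?s) * expect n (\<lambda>xs. \<bar>diag_sum xs\<bar>) + 1 / ?s)"
    by (simp only: expect_mult_left expect_add expect_const)
  also have "\<dots> \<le> \<bar>t\<bar> * (1 / (n * ?s) * sqrt (real n * inv_var) + 1 / ?s)"
    using s by (intro mult_left_mono add_mono expect_abs_diag_sum) auto
  also have "\<dots> = ?R" by simp
  finally have "cmod (?E - expect n (\<lambda>xs. iexp (t * (c * pair_sum xs)))) \<le> ?R" .
  moreover note pair_sum_char_bound[OF n L \<delta> c, of t]
  moreover have "cmod (?E - ?e) \<le> cmod (?E - expect n (\<lambda>xs. iexp (t * (c * pair_sum xs)))) +
      cmod (expect n (\<lambda>xs. iexp (t * (c * pair_sum xs))) - ?e)"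
    by (rule norm_diff_triangle_ineq[THEN order_trans[rotated]]) simp
  ultimately show ?thesis by linarith
qed

end

section \<open>Transfer to probability spaces and the limit\<close>

context prob_space
begin

lemma expectation_finite_range:
  fixes f :: "'b \<Rightarrow> 'c::{banach, second_countable_topology}"
  assumes Z: "Z \<in> M \<rightarrow>\<^sub>M count_space B" and B: "finite B"
  shows "expectation (\<lambda>\<omega>. f (Z \<omega>)) = (\<Sum>x\<in>B. prob (Z -` {x} \<inter> space M) *\<^sub>R f x)"
proof -
  have ev: "Z -` {x} \<inter> space M \<in> events" if "x \<in> B" for x
    using measurable_sets[OF Z, of "{x}"] that by simp
  have "expectation (\<lambda>\<omega>. f (Z \<omega>)) =
      expectation (\<lambda>\<omega>. \<Sum>x\<in>B. indicator (Z -` {x} \<inter> space M) \<omega> *\<^sub>R f x)"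
  proof (rule Bochner_Integration.integral_cong)
    fix \<omega> assume \<omega>: "\<omega> \<in> space M"
    then have "Z \<omega> \<in> B" using measurable_space[OF Z] by simp
    have "(\<Sum>x\<in>B. indicator (Z -` {x} \<inter> space M) \<omega> *\<^sub>R f x) = (\<Sum>x\<in>B. if x = Z \<omega> then f x else 0)"
      by (rule sum.cong) (auto simp: indicator_def \<omega>)
    then show "f (Z \<omega>) = (\<Sum>x\<in>B. indicator (Z -` {x} \<inter> space M) \<omega> *\<^sub>R f x)"
      using B \<open>Z \<omega> \<in> B\<close> by simp
  qed simp
  also have "\<dots> = (\<Sum>x\<in>B. expectation (\<lambda>\<omega>. indicator (Z -` {x} \<inter> space M) \<omega> *\<^sub>R f x))"
    using ev by (intro Bochner_Integration.integral_sum integrable_scaleR_left integrable_real_indicator)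
      (auto simp: emeasure_eq_measure)
  also have "\<dots> = (\<Sum>x\<in>B. prob (Z -` {x} \<inter> space M) *\<^sub>R f x)"
    using ev by (intro sum.cong) (auto simp: emeasure_eq_measure)
  finally show ?thesis .
qed

context
  fixes A :: "'b set" and p :: "'b \<Rightarrow> real" and Y :: "nat \<Rightarrow> 'a \<Rightarrow> 'b" and n :: nat
  assumes law: "finite_law A p"
    and n: "n \<ge> 1"
    and indep: "indep_vars (\<lambda>_. count_space A) Y {1..n}"
    and Y: "\<And>k x. k \<in> {1..n} \<Longrightarrow> x \<in> A \<Longrightarrow> prob (Y k -` {x} \<inter> space M) = p x"
begin

interpretation finite_law A p by (rule law)

lemma iid_list_vimage:
  assumes xs: "xs \<in> samples n"
  shows "(\<lambda>\<omega>. map (\<lambda>k. Y k \<omega>) [1..<Suc n]) -` {xs} \<inter> space M =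
    (\<Inter>k\<in>{1..n}. Y k -` {xs ! (k - 1)} \<inter> space M)"
proof -
  have "map (\<lambda>k. Y k \<omega>) [1..<Suc n] = xs \<longleftrightarrow> (\<forall>k\<in>{1..n}. Y k \<omega> = xs ! (k - 1))" for \<omega>
  proof
    assume "map (\<lambda>k. Y k \<omega>) [1..<Suc n] = xs"
    then show "\<forall>k\<in>{1..n}. Y k \<omega> = xs ! (k - 1)" by (auto simp del: upt_Suc)
  next
    assume *: "\<forall>k\<in>{1..n}. Y k \<omega> = xs ! (k - 1)"
    show "map (\<lambda>k. Y k \<omega>) [1..<Suc n] = xs"
      by (rule nth_equalityI) (use * in \<open>auto simp: samples_length[OF xs] simp del: upt_Suc\<close>)
  qed
  \<comment> \<open>With n \<ge> 1 the intersection is over a nonempty index set and so stays inside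
    \<open>space M\<close>.\<close>
  then show ?thesis using n by auto
qed

lemma measurable_iid_list:
  "(\<lambda>\<omega>. map (\<lambda>k. Y k \<omega>) [1..<Suc n]) \<in> M \<rightarrow>\<^sub>M count_space (samples n)"
proof -
  have rv: "Y k \<in> M \<rightarrow>\<^sub>M count_space A" if "k \<in> {1..n}" for k
    using indep that by (auto simp: indep_vars_def)
  have "Y k \<omega> \<in> A" if "k \<in> {1..n}" "\<omega> \<in> space M" for k \<omega>
    using measurable_space[OF rv] that by auto
  moreover have "(\<Inter>k\<in>{1..n}. Y k -` {xs ! (k - 1)} \<inter> space M) \<in> events" if "xs \<in> samples n" for xs
  proof (intro sets.finite_INT)
    fix k assume k: "k \<in> {1..n}"
    then have "xs ! (k - 1) \<in> set xs" using samples_length[OF that] by (intro nth_mem) auto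
    then have "xs ! (k - 1) \<in> A" using samplesD[OF that] by auto
    then show "Y k -` {xs ! (k - 1)} \<inter> space M \<in> events"
      using measurable_sets[OF rv[OF k], of "{xs ! (k - 1)}"] by simp
  qed (use n in auto)
  ultimately show ?thesis
    unfolding measurable_count_space_eq2[OF finite_samples]
    by (intro conjI ballI) (auto simp only: iid_list_vimage, auto simp: samples_def simp del: upt_Suc)
qed

text \<open>The head of the list is \<open>Y 1\<close>, so time in the martingale argument runs from
  \<open>Y n\<close> back to \<open>Y 1\<close>. The joint law is a product of identical factors,
  hence insensitive to this order.\<close>

lemma expectation_iid_list:
  fixes f :: "'b list \<Rightarrow> 'd::{banach, second_countable_topology}"
  shows "expectation (\<lambda>\<omega>. f (map (\<lambda>k. Y k \<omega>) [1..<Suc n])) = expect n f"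
proof -
  have "prob ((\<lambda>\<omega>. map (\<lambda>k. Y k \<omega>) [1..<Suc n]) -` {xs} \<inter> space M) = prod_list (map p xs)"
    if xs: "xs \<in> samples n" for xs
  proof -
    have A: "xs ! (k - 1) \<in> A" if k: "k \<in> {1..n}" for k
    proof -
      have "xs ! (k - 1) \<in> set xs" using samples_length[OF xs] k by (intro nth_mem) auto
      then show ?thesis using samplesD[OF xs] by auto
    qed
    have "prob ((\<lambda>\<omega>. map (\<lambda>k. Y k \<omega>) [1..<Suc n]) -` {xs} \<inter> space M) =
        (\<Prod>k\<in>{1..n}. prob (Y k -` {xs ! (k - 1)} \<inter> space M))"
      unfolding iid_list_vimage[OF xs] by (rule indep_varsD_finite[OF indep]) (use n A in auto)
    also have "\<dots> = (\<Prod>k\<in>{1..n}. p (xs ! (k - 1)))"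
      by (intro prod.cong refl Y A)
    also have "\<dots> = (\<Prod>i\<in>{0..<n}. map p xs ! i)"
      by (rule prod.reindex_bij_witness[where i = Suc and j = "\<lambda>k. k - 1"])
        (auto simp: samples_length[OF xs])
    also have "\<dots> = prod_list (map p xs)"
      by (simp add: prod.list_conv_set_nth samples_length[OF xs])
    finally show ?thesis .
  qed
  then show ?thesis
    unfolding expect_def expectation_finite_range[OF measurable_iid_list finite_samples]
    by (intro sum.cong) auto
qed

lemma
  assumes g: "\<And>\<omega>. g \<omega> = G (map (\<lambda>k. Y k \<omega>) [1..<Suc n])"
  shows measurable_iid_statistic: "g \<in> borel_measurable M"
    and char_iid_statistic: "char (distr M borel g) t = expect n (\<lambda>xs. iexp (t * G xs))"
proof -
  have g': "g = (\<lambda>\<omega>. G (map (\<lambda>k. Y k \<omega>) [1..<Suc n]))" using g by auto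
  show meas: "g \<in> borel_measurable M"
    unfolding g' by (rule measurable_compose[OF measurable_iid_list]) simp
  have "char (distr M borel g) t = expectation (\<lambda>\<omega>. iexp (t * g \<omega>))"
    unfolding char_def by (rule integral_distr[OF meas]) simp
  then show "char (distr M borel g) t = expect n (\<lambda>xs. iexp (t * G xs))"
    unfolding g by (simp only: expectation_iid_list[symmetric])
qed

end

end

section \<open>Identification of the statistic and passage to the limit\<close>

lemma count_list_map_upt:
  "count_list (map f [1..<Suc n]) i = (\<Sum>k=1..n. of_bool (f k = i))"
proof (induction n)
  case (Suc n)
  then show ?case
    using upt_Suc_append[of 1 "Suc n"] by (auto simp del: upt_Suc)
qed simp

lemma pearson_chi2_eq:
  assumes "finite_law {1..m} p" "n \<ge> 1"
  shows "pearson_chi2 n m p Y \<omega> = finite_law.chi2 {1..m} p (map (\<lambda>k. Y k \<omega>) [1..<Suc n])"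
  unfolding pearson_chi2_def emp_freq_def finite_law.chi2_def[OF assms(1)] count_list_map_upt
  by (simp del: upt_Suc)

text \<open>By the choice of \<open>L\<close>, L^5 m / n^2 equals sqrt m / n and L^4 / n equals 1 /
  (L sqrt m). The variance \<open>\<sigma>\<close> enters only through q = \<sigma> / (m n), and
  \<open>\<mu>\<close>, being bounded, only against a vanishing power of \<open>L\<close>.\<close>

lemma chi2_bound_tendsto_0:
  fixes m :: "nat \<Rightarrow> nat" and L \<sigma> \<mu> :: "nat \<Rightarrow> real" and t :: real
  defines "L \<equiv> \<lambda>n. (real n / sqrt (real (m n))) powr (1 / 5)"
  assumes m: "filterlim m at_top sequentially"
    and growth: "filterlim (\<lambda>n. real n / sqrt (real (m n))) at_top sequentially"
    and \<sigma>: "(\<lambda>n. \<sigma> n / (real (m n) * real n)) \<longlonglongrightarrow> 0"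
    and \<mu>: "\<And>n. n \<ge> 1 \<Longrightarrow> 0 \<le> \<mu> n \<and> \<mu> n \<le> C"
    and \<delta>: "\<delta> > 0"
  shows "(\<lambda>n. exp (t\<^sup>2) *
     ((2 * t\<^sup>2 / L n + 2 * t\<^sup>2 * (2 * t\<^sup>2 * (L n ^ 5 * m n / (real n)\<^sup>2 + 3 * L n ^ 4 / n)
        + L n powr (- \<delta>) * \<mu> n))
      + t ^ 4 / 8 * (12 * (4 / (real n * m n) + \<sigma> n / (real n * m n)\<^sup>2 + 1 / n))
      + (2 + t\<^sup>2 / 2) * (2 / (real n * m n) * (2 * (real n * sqrt (m n)) + sqrt (real n * \<sigma> n))
          + 1 / m n + 1 / n))
    + \<bar>t\<bar> * (sqrt (real n * \<sigma> n) / (n * sqrt (2 * real (m n))) + 1 / sqrt (2 * real (m n))))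
    \<longlonglongrightarrow> 0"
proof -
  let ?b = "\<lambda>n. 1 / sqrt (real (m n))" and ?q = "\<lambda>n. \<sigma> n / (real (m n) * real n)"
  have m': "filterlim (\<lambda>n. real (m n)) at_top sequentially"
    by (rule filterlim_compose[OF filterlim_real_sequentially m])
  have ev: "\<forall>\<^sub>F n in sequentially. n \<ge> 1 \<and> m n \<ge> 1"
    using eventually_ge_at_top[of 1] m by (auto simp: filterlim_at_top intro: eventually_conj)
  have im: "(\<lambda>n. 1 / real (m n)) \<longlonglongrightarrow> 0"
    using tendsto_inverse_0_at_top[OF m'] by (simp add: field_simps)
  have b: "?b \<longlonglongrightarrow> 0"
    using tendsto_real_sqrt[OF im] by (simp add: real_sqrt_divide)
  have ni: "(\<lambda>n. 1 / real n) \<longlonglongrightarrow> 0" by (rule lim_1_over_n)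
  have L_top: "filterlim L at_top sequentially"
    unfolding L_def by (rule filterlim_compose[OF real_powr_at_top growth]) simp
  have a: "(\<lambda>n. 1 / L n) \<longlonglongrightarrow> 0"
    using tendsto_inverse_0_at_top[OF L_top] by (simp add: field_simps)
  have r: "(\<lambda>n. 1 / (real n / sqrt (real (m n)))) \<longlonglongrightarrow> 0"
    using tendsto_inverse_0_at_top[OF growth] by (simp add: field_simps)
  have L5: "L n ^ 5 = real n / sqrt (real (m n))" if "n \<ge> 1 \<and> m n \<ge> 1" for n
    unfolding L_def by (subst powr_realpow[symmetric]) (use that in \<open>auto simp: powr_powr\<close>)
  have T1: "(\<lambda>n. L n ^ 5 * m n / (real n)\<^sup>2) \<longlonglongrightarrow> 0"
    by (rule Lim_transform_eventually[OF r], rule eventually_mono[OF ev])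
      (auto simp: L5 field_simps power2_eq_square)
  have T2: "(\<lambda>n. L n ^ 4 / n) \<longlonglongrightarrow> 0"
  proof (rule Lim_transform_eventually)
    show "(\<lambda>n. ?b n * (1 / L n)) \<longlonglongrightarrow> 0" using tendsto_mult[OF b a] by simp
    show "\<forall>\<^sub>F n in sequentially. ?b n * (1 / L n) = L n ^ 4 / n"
      using ev
    proof eventually_elim
      case (elim n)
      then have "L n > 0" unfolding L_def by auto
      then have "L n ^ 4 = L n ^ 5 / L n" by (simp add: eval_nat_numeral)
      then have "L n ^ 4 = real n / sqrt (real (m n)) / L n" unfolding L5[OF elim] .
      then show ?case using elim by simp
    qed
  qed
  have T3: "(\<lambda>n. L n powr (- \<delta>) * \<mu> n) \<longlonglongrightarrow> 0"
  proof (rule tendsto_sandwich[OF _ _ tendsto_const])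
    have "(\<lambda>n. L n powr (- \<delta>)) \<longlonglongrightarrow> 0"
      by (rule tendsto_neg_powr[OF _ L_top]) (use \<delta> in auto)
    then show "(\<lambda>n. L n powr (- \<delta>) * C) \<longlonglongrightarrow> 0" using tendsto_mult_left_zero by blast
  qed (use \<mu> in \<open>auto intro!: eventually_mono[OF ev] mult_left_mono\<close>)
  have T4: "(\<lambda>n. 1 / (real n * m n)) \<longlonglongrightarrow> 0"
    using tendsto_mult[OF ni im] by simp
  have T5: "(\<lambda>n. \<sigma> n / (real n * m n)\<^sup>2) \<longlonglongrightarrow> 0"
    by (rule Lim_transform_eventually[OF tendsto_mult[OF \<sigma> T4, simplified]])
      (simp add: power2_eq_square mult.commute)
  have sq: "(\<lambda>n. sqrt (?q n)) \<longlonglongrightarrow> 0" using tendsto_real_sqrt[OF \<sigma>] by simp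
  \<comment> \<open>Pulling out n sqrt m turns both square-root error terms into multiples of sqrt
    q.\<close>
  have sq_eq: "sqrt (real n * \<sigma> n) = n * sqrt (real (m n)) * sqrt (?q n)" if "n \<ge> 1 \<and> m n \<ge> 1" for n
  proof -
    have "real n * \<sigma> n = (real n)\<^sup>2 * real (m n) * ?q n"
      using that by (simp add: power2_eq_square)
    then show ?thesis by (simp only: real_sqrt_mult real_sqrt_abs real_sqrt_pow2 abs_of_nat)
  qed
  have T6: "(\<lambda>n. 2 / (real n * m n) * (2 * (real n * sqrt (m n)) + sqrt (real n * \<sigma> n))) \<longlonglongrightarrow> 0"
  proof (rule Lim_transform_eventually)
    show "(\<lambda>n. 4 * ?b n + 2 * (sqrt (?q n) * ?b n)) \<longlonglongrightarrow> 0"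
      using tendsto_add[OF tendsto_mult_left[OF b, of 4] tendsto_mult_left[OF tendsto_mult[OF sq b], of 2]]
      by simp
    show "\<forall>\<^sub>F n in sequentially. 4 * ?b n + 2 * (sqrt (?q n) * ?b n) =
        2 / (real n * m n) * (2 * (real n * sqrt (m n)) + sqrt (real n * \<sigma> n))"
      using ev
    proof eventually_elim
      case (elim n)
      have *: "2 / (real n * (s * s)) * (n * s * x) = 2 * (x * (1 / s))" if "s > 0" for s x :: real
        using elim that by (simp add: field_simps)
      have "2 / (real n * m n) * (n * sqrt (m n) * x) = 2 * (x * ?b n)" for x
        using *[of "sqrt (m n)" x] elim by simp
      from this[of 2] this[of "sqrt (?q n)"] show ?case
        unfolding sq_eq[OF elim] distrib_left by (simp add: mult_ac)
    qed
  qed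
  have T7: "(\<lambda>n. sqrt (real n * \<sigma> n) / (n * sqrt (2 * real (m n)))) \<longlonglongrightarrow> 0"
  proof (rule Lim_transform_eventually)
    show "(\<lambda>n. sqrt (?q n) / sqrt 2) \<longlonglongrightarrow> 0" using tendsto_divide[OF sq tendsto_const[of "sqrt 2"]] by simp
    show "\<forall>\<^sub>F n in sequentially. sqrt (?q n) / sqrt 2 = sqrt (real n * \<sigma> n) / (n * sqrt (2 * real (m n)))"
      using ev by eventually_elim (simp only: sq_eq, simp add: real_sqrt_mult)
  qed
  have T8: "(\<lambda>n. 1 / sqrt (2 * real (m n))) \<longlonglongrightarrow> 0"
    using tendsto_mult[OF tendsto_const[of "1 / sqrt 2"] b] by (simp add: real_sqrt_mult)
  have "(\<lambda>n. exp (t\<^sup>2) *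
     ((2 * t\<^sup>2 * (1 / L n) + 2 * t\<^sup>2 * (2 * t\<^sup>2 * (L n ^ 5 * m n / (real n)\<^sup>2 + 3 * (L n ^ 4 / n))
        + L n powr (- \<delta>) * \<mu> n))
      + t ^ 4 / 8 * (12 * (4 * (1 / (real n * m n)) + \<sigma> n / (real n * m n)\<^sup>2 + 1 / n))
      + (2 + t\<^sup>2 / 2) * (2 / (real n * m n) * (2 * (real n * sqrt (m n)) + sqrt (real n * \<sigma> n))
          + 1 / m n + 1 / n))
    + \<bar>t\<bar> * (sqrt (real n * \<sigma> n) / (n * sqrt (2 * real (m n))) + 1 / sqrt (2 * real (m n))))
    \<longlonglongrightarrow> exp (t\<^sup>2) * ((2 * t\<^sup>2 * 0 + 2 * t\<^sup>2 * (2 * t\<^sup>2 * (0 + 3 * 0) + 0))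
      + t ^ 4 / 8 * (12 * (4 * 0 + 0 + 0)) + (2 + t\<^sup>2 / 2) * (0 + 0 + 0)) + \<bar>t\<bar> * (0 + 0)"
    by (intro tendsto_add tendsto_mult tendsto_const a T1 T2 T3 T4 T5 T6 T7 T8 im ni)
  then show ?thesis by simp
qed

text \<open>The assumptions concern n \<ge> 1, so at index 0 the law may fail to be a probability
  measure. Levy's continuity theorem is therefore applied to the shifted sequence.\<close>

lemma weak_conv_m_imp_Suc: "weak_conv_m (\<lambda>n. K (Suc n)) S \<Longrightarrow> weak_conv_m K S"
  unfolding weak_conv_m_def weak_conv_def by (auto intro: LIMSEQ_imp_Suc)

theorem theorem2p2:
  fixes m :: "nat \<Rightarrow> nat"
    and p :: "nat \<Rightarrow> nat \<Rightarrow> real"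
    and N :: "nat \<Rightarrow> 'b measure" and X :: "nat \<Rightarrow> 'b \<Rightarrow> nat"
    and M :: "nat \<Rightarrow> 'a measure" and Xs :: "nat \<Rightarrow> nat \<Rightarrow> 'a \<Rightarrow> nat"
  assumes m_pos: "\<And>n. n \<ge> 1 \<Longrightarrow> m n \<ge> 1"
    and m_lim: "filterlim m at_top sequentially"
    and prob_N: "\<And>n. n \<ge> 1 \<Longrightarrow> prob_space (N n)"
    and X_rv: "\<And>n. n \<ge> 1 \<Longrightarrow> X n \<in> measurable (N n) (count_space {1..m n})"
    and X_prob: "\<And>n i. n \<ge> 1 \<Longrightarrow> i \<in> {1..m n} \<Longrightarrow> \<P>(\<omega> in N n. X n \<omega> = i) = p n i"
    and p_pos: "\<And>n i. n \<ge> 1 \<Longrightarrow> i \<in> {1..m n} \<Longrightarrow> p n i > 0"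
    and prob_M: "\<And>n. n \<ge> 1 \<Longrightarrow> prob_space (M n)"
    and Xs_indep: "\<And>n. n \<ge> 1 \<Longrightarrow>
      prob_space.indep_vars (M n) (\<lambda>_. count_space {1..m n}) (Xs n) {1..n}"
    and Xs_distr: "\<And>n k. n \<ge> 1 \<Longrightarrow> k \<in> {1..n} \<Longrightarrow>
      distr (M n) (count_space {1..m n}) (Xs n k) = distr (N n) (count_space {1..m n}) (X n)"
    and var_cond: "(\<lambda>n. 1 / (real (m n) * real n) *
      prob_space.variance (N n) (\<lambda>\<omega>. 1 / p n (X n \<omega>))) \<longlonglongrightarrow> 0"
    and moment_cond: "\<exists>\<delta>>0. bdd_above ((\<lambda>n. real (m n) powr (-(1 + \<delta>)) *
      prob_space.expectation (N n) (\<lambda>\<omega>. p n (X n \<omega>) powr (-(1 + \<delta>)))) ` {1..})"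
    and growth: "filterlim (\<lambda>n. real n / sqrt (real (m n))) at_top sequentially"
  shows "weak_conv_m
    (\<lambda>n. distr (M n) borel
      (\<lambda>\<omega>. (pearson_chi2 n (m n) (p n) (Xs n) \<omega> - real (m n)) / sqrt (2 * real (m n))))
    std_normal_distribution"
proof -
  let ?A = "\<lambda>n. {1..m n}"
  let ?W = "\<lambda>n \<omega>. (pearson_chi2 n (m n) (p n) (Xs n) \<omega> - real (m n)) / sqrt (2 * real (m n))"
  let ?G = "\<lambda>n xs. (finite_law.chi2 (?A n) (p n) xs - real (m n)) / sqrt (2 * real (m n))"
  let ?L = "\<lambda>n. (real n / sqrt (real (m n))) powr (1 / 5)"
  let ?\<sigma> = "\<lambda>n. finite_law.inv_var (?A n) (p n)"
  let ?\<mu> = "\<lambda>n. finite_law.inv_moment (?A n) (p n)"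
  have X_prob': "measure (N n) (X n -` {i} \<inter> space (N n)) = p n i" if "n \<ge> 1" "i \<in> ?A n" for n i
    using X_prob[OF that] by (simp add: vimage_def Int_def conj_commute)
  have X_expect: "prob_space.expectation (N n) (\<lambda>\<omega>. f (X n \<omega>)) = (\<Sum>i\<in>?A n. p n i * f i)"
    if n: "n \<ge> 1" for n and f :: "nat \<Rightarrow> real"
    using prob_space.expectation_finite_range[OF prob_N[OF n] X_rv[OF n], of f] X_prob'[OF n] by simp
  have law: "finite_law (?A n) (p n)" if n: "n \<ge> 1" for n
  proof
    \<comment> \<open>The expectation of the constant 1 is the total mass, since \<open>X n\<close>
      takes all its values in \<open>?A n\<close>.\<close>
    show "sum (p n) (?A n) = 1"
      using X_expect[OF n, of "\<lambda>_. 1"] by (simp add: prob_space.prob_space prob_N[OF n])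
  qed (use p_pos[OF n] in auto)
  have Y: "measure (M n) (Xs n k -` {i} \<inter> space (M n)) = p n i"
    if n: "n \<ge> 1" and k: "k \<in> {1..n}" and i: "i \<in> ?A n" for n k i
  proof -
    have "Xs n k \<in> M n \<rightarrow>\<^sub>M count_space (?A n)"
      using Xs_indep[OF n] k by (auto simp: prob_space.indep_vars_def[OF prob_M[OF n]])
    then have "measure (M n) (Xs n k -` {i} \<inter> space (M n)) = measure (distr (M n) (count_space (?A n)) (Xs n k)) {i}"
      using i by (subst measure_distr) auto
    also have "\<dots> = p n i"
      unfolding Xs_distr[OF n k] using X_rv[OF n] X_prob'[OF n i] i by (subst measure_distr) auto
    finally show ?thesis .
  qed
  have var: "prob_space.variance (N n) (\<lambda>\<omega>. 1 / p n (X n \<omega>)) = ?\<sigma> n" if n: "n \<ge> 1" for n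
    unfolding X_expect[OF n, of "\<lambda>i. 1 / p n i"] X_expect[OF n, of "\<lambda>i. (1 / p n i - _)\<^sup>2"]
      finite_law.inv_var_def[OF law[OF n]] finite_law.sum_p_inverse[OF law[OF n]] by simp
  have \<sigma>: "(\<lambda>n. ?\<sigma> n / (real (m n) * real n)) \<longlonglongrightarrow> 0"
    by (rule Lim_transform_eventually[OF var_cond])
      (auto intro!: eventually_mono[OF eventually_ge_at_top[of 1]] simp: var)
  obtain \<delta> C where \<delta>: "\<delta> > 0" and C: "\<And>n. n \<ge> 1 \<Longrightarrow> real (m n) powr (-(1 + \<delta>)) *
      prob_space.expectation (N n) (\<lambda>\<omega>. p n (X n \<omega>) powr (-(1 + \<delta>))) \<le> C"
    using moment_cond by (auto simp: bdd_above_def)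
  \<comment> \<open>Splitting the power of 1/(m p) into powers of m and of p identifies
    \<open>inv_moment\<close> with the bounded expression of the hypothesis.\<close>
  have \<mu>: "0 \<le> ?\<mu> n \<delta> \<and> ?\<mu> n \<delta> \<le> C" if n: "n \<ge> 1" for n
  proof -
    have m: "real (m n) > 0" using m_pos[OF n] by simp
    have "(1 / (p n i * real (m n))) powr (1 + \<delta>) = real (m n) powr (-(1 + \<delta>)) * p n i powr (-(1 + \<delta>))"
      if "i \<in> ?A n" for i
    proof -
      have "(1 / (a * b)) powr s = b powr (- s) * a powr (- s)" if "a > 0" "b > 0" for a b s :: real
        using that by (simp add: powr_divide powr_mult powr_minus_divide)
      then show ?thesis using p_pos[OF n that] m by blast
    qed
    then have "?\<mu> n \<delta> = real (m n) powr (-(1 + \<delta>)) * (\<Sum>i\<in>?A n. p n i * p n i powr (-(1 + \<delta>)))"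
      unfolding finite_law.inv_moment_def[OF law[OF n]] sum_distrib_left by (intro sum.cong) auto
    then have "?\<mu> n \<delta> \<le> C" using C[OF n] X_expect[OF n, of "\<lambda>i. p n i powr (-(1 + \<delta>))"] by simp
    moreover have "0 \<le> ?\<mu> n \<delta>"
      unfolding finite_law.inv_moment_def[OF law[OF n]]
      using p_pos[OF n] by (intro sum_nonneg mult_nonneg_nonneg) (auto intro: less_imp_le)
    ultimately show ?thesis by simp
  qed
  have W: "?W n \<omega> = ?G n (map (\<lambda>k. Xs n k \<omega>) [1..<Suc n])" if "n \<ge> 1" for n \<omega>
    by (simp only: pearson_chi2_eq[OF law[OF that] that])
  have W_meas: "?W n \<in> borel_measurable (M n)" and
    W_char: "char (distr (M n) borel (?W n)) t = finite_law.expect (?A n) (p n) n (\<lambda>xs. iexp (t * ?G n xs))"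
    if n: "n \<ge> 1" for n t
    by (rule prob_space.measurable_iid_statistic[where Y = "Xs n" and G = "?G n",
          OF prob_M[OF n] law[OF n] n Xs_indep[OF n] Y[OF n] W[OF n]]; assumption)
      (rule prob_space.char_iid_statistic[where Y = "Xs n" and G = "?G n",
          OF prob_M[OF n] law[OF n] n Xs_indep[OF n] Y[OF n] W[OF n]]; assumption)
  have "(\<lambda>n. char (distr (M n) borel (?W n)) t - of_real (exp (- (t\<^sup>2) / 2))) \<longlonglongrightarrow> 0" for t
  \<comment> \<open>The level in \<open>chi2_char_bound\<close> is free for each n, so it may be
    taken as the n-dependent \<open>?L n\<close>.\<close>
  proof (rule Lim_null_comparison[OF _ chi2_bound_tendsto_0[OF m_lim growth \<sigma> \<mu> \<delta>, where t = t]])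
    show "\<forall>\<^sub>F n in sequentially. norm (char (distr (M n) borel (?W n)) t - of_real (exp (- (t\<^sup>2) / 2))) \<le>
      exp (t\<^sup>2) *
       ((2 * t\<^sup>2 / ?L n + 2 * t\<^sup>2 * (2 * t\<^sup>2 * (?L n ^ 5 * m n / (real n)\<^sup>2 + 3 * ?L n ^ 4 / n)
          + ?L n powr (- \<delta>) * ?\<mu> n \<delta>))
        + t ^ 4 / 8 * (12 * (4 / (real n * m n) + ?\<sigma> n / (real n * m n)\<^sup>2 + 1 / n))
        + (2 + t\<^sup>2 / 2) * (2 / (real n * m n) * (2 * (real n * sqrt (m n)) + sqrt (real n * ?\<sigma> n))
            + 1 / m n + 1 / n))
      + \<bar>t\<bar> * (sqrt (real n * ?\<sigma> n) / (n * sqrt (2 * real (m n))) + 1 / sqrt (2 * real (m n)))"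
      using eventually_ge_at_top[of 1]
    proof eventually_elim
      case (elim n)
      have L: "?L n > 0" using elim m_pos[OF elim] by auto
      show ?case
        unfolding W_char[OF elim] using finite_law.chi2_char_bound[OF law[OF elim] elim L \<delta>, of t] by simp
    qed
  qed
  then have char: "(\<lambda>n. char (distr (M n) borel (?W n)) t) \<longlonglongrightarrow> char std_normal_distribution t" for t
    by (simp add: char_std_normal_distribution LIM_zero_iff)
  have "weak_conv_m (\<lambda>n. distr (M (Suc n)) borel (?W (Suc n))) std_normal_distribution"
  proof (rule levy_continuity)
    fix n
    interpret prob_space "M (Suc n)" by (rule prob_M) simp
    show "real_distribution (distr (M (Suc n)) borel (?W (Suc n)))"
      by (rule real_distribution_distr[OF W_meas]) simp
  next
    show "real_distribution std_normal_distribution"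
      by (rule real_dist_normal_dist)
    show "(\<lambda>n. char (distr (M (Suc n)) borel (?W (Suc n))) t) \<longlonglongrightarrow> char std_normal_distribution t" for t
      by (rule LIMSEQ_Suc[OF char])
  qed
  then show ?thesis by (rule weak_conv_m_imp_Suc)
qed

end
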